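(* Let $(X,G)$ be a minimal dynamical system, and let $H$ be a finite subgroup of $G$. (1) If $(X,G)$ is topologically free and $H$ is almost normal, then the following are equivalent: (1.1) There exists a factor map $\phi:X\to G/N_G(H)$, where $G$ acts on $G/N_G(H)=\{gN_G(H):g\in G\}$ by left multiplication. (1.2) There exist a minimal dynamical system $(Y,G)$ and a $|H|$-to-one factor map $\pi:X\to Y$ such that $\pi^{-1}(Y_H)=\{x\in X: G_x=\{1_G\}\}$. In the situation of (1.2), $\mathrm{Conj}(H)$ is the stabilizer URS of $(Y,G)$, and, if $Y$ is a metric space, $(Y,G)$ is locally quasi-analytic. (2) If $(X,G,\mu)$ is essentially free with respect to an ergodic measure $\mu$, then the following are equivalent: (2.1) $H$ is almost normal and there exists a factor map $\phi:X\to G/N_G(H)$. (2.2) There exist a minimal dynamical system $(Y,G)$ and a $|H|$-to-one factor map $\pi:X\to Y$ such that $\pi^{-1}(Y_H)=\{x\in X: G_x=\{1_G\}\}$. (2.3) There exist a minimal dynamical system $(Y,G)$ and a factor map $\pi:X\to Y$ which is $|H|$-to-one $\pi_*\mu$-a.e. such that $\pi_*\mu(Y_H)=1$. In the situation of (2.3), $\mathrm{Conj}(H)$ is the stabilizer URS of $(Y,G,\pi_*\mu)$, and the IRS of $(Y,G,\pi_*\mu)$ is supported on its stabilizer URS. In particular, $(Y,G,\pi_*\mu)$ has no essential holonomy, and, if $Y$ is a metric space, $(Y,G)$ is locally quasi-analytic.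
   Context: A dynamical system $(X,G)$ is a countable discrete finitely generated group $G$ acting by homeomorphisms on a compact Hausdorff space $X$. It is minimal if $X$ is the only non-empty closed $G$-invariant subset of $X$. An invariant measure is a $G$-invariant Borel probability measure on $X$; it is ergodic if invariant Borel sets have measure $0$ or $1$. $G_x=\{g\in G: gx=x\}$. $(X,G)$ is topologically free if the set of points with trivial stabilizer is residual; $(X,G,\mu)$ is essentially free if $\mu$-a.e. point has trivial stabilizer. A factor map $\pi:X\to Y$ between systems $(X,G)$, $(Y,G)$ is a continuous surjective $G$-equivariant map; it is $n$-to-one if $|\pi^{-1}\{y\}|=n$ for every $y\in Y$, and $n$-to-one $\nu$-a.e. if this holds for $\nu$-a.e. $y$. Finite coset spaces carry the discrete topology. A subgroup $H$ of $G$ is almost normal if its normalizer $N_G(H)$ has finite index in $G$. $\mathrm{Conj}(H)$ is the set of conjugates of $H$ in $G$, and $Y_H=\{y\in Y: G_y\in\mathrm{Conj}(H)\}$. A point $x$ has trivial holonomy if every $g\in G_x$ fixes every point of some open neighborhood of $x$. $(Y,G,\nu)$ has no essential holonomy if $\nu$-a.e. point has trivial holonomy. $S(G)$ is the space of subgroups of $G$ with the Chabauty--Fell topology, with basic open sets $U(A,B)=\{K\in S(G): A\subset K,\ B\cap K=\emptyset\}$, $A,B\subset G$ finite; $G$ acts by conjugation. The stabilizer URS of a minimal system $(Y,G)$ is the closure in $S(G)$ of $\{G_y: y\in Y\text{ has trivial holonomy}\}$; it is the unique minimal closed conjugation-invariant subset of the closure of $\{G_y:y\in Y\}$. The IRS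 of $(Y,G,\nu)$ is the push-forward of $\nu$ under $y\mapsto G_y\in S(G)$; it is supported on the stabilizer URS if that set has full measure for it. If $Y$ has a compatible metric, $(Y,G)$ is locally quasi-analytic if there is $\epsilon>0$ such that for every open $U\subset Y$ with $\mathrm{diam}(U)<\epsilon$ and every $g\in G$: if $g|V=\mathrm{id}$ for some non-empty open $V\subset U$, then $g|U=\mathrm{id}$. *)

theory Defs
  imports
    "HOL-Probability.Probability_Measure"
    "HOL-Algebra.Group_Action"
    "HOL-Algebra.Left_Coset"
    "HOL-Algebra.Generated_Groups"
begin

section \<open>Groups\<close>

definition finitely_generated_group :: "('g, 'm) monoid_scheme \<Rightarrow> bool" where
  "finitely_generated_group G \<longleftrightarrow>
     group G \<and> (\<exists>S. finite S \<and> S \<subseteq> carrier G \<and> generate G S = carrier G)"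

definition conjugates :: "('g, 'm) monoid_scheme \<Rightarrow> 'g set \<Rightarrow> 'g set set" where
  "conjugates G H = {g <#\<^bsub>G\<^esub> H #>\<^bsub>G\<^esub> (inv\<^bsub>G\<^esub> g) | g. g \<in> carrier G}"

definition almost_normal :: "('g, 'm) monoid_scheme \<Rightarrow> 'g set \<Rightarrow> bool" where
  "almost_normal G H \<longleftrightarrow> subgroup H G \<and> finite (lcosets\<^bsub>G\<^esub> (normalizer G H))"

text \<open>Actions are maps into \<^const>\<open>BijGroup\<close>, whose elements are extensional; hence the
  restricted abstraction.\<close>

definition coset_action :: "('g, 'm) monoid_scheme \<Rightarrow> 'g set \<Rightarrow> 'g \<Rightarrow> 'g set \<Rightarrow> 'g set" where
  "coset_action G K = (\<lambda>g. \<lambda>C \<in> lcosets\<^bsub>G\<^esub> K. g <#\<^bsub>G\<^esub> C)"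

section \<open>Dynamical systems\<close>

locale dynamical_system = group_action G "topspace X" \<alpha>
  for G :: "('g, 'm) monoid_scheme" (structure)
    and X :: "'x topology" and \<alpha> :: "'g \<Rightarrow> 'x \<Rightarrow> 'x" +
  assumes countable_group: "countable (carrier G)"
    and finitely_generated: "finitely_generated_group G"
    and compact: "compact_space X"
    and Hausdorff: "Hausdorff_space X"
    and homeo: "g \<in> carrier G \<Longrightarrow> homeomorphic_map X X (\<alpha> g)"

text \<open>The space of a minimal system is itself one of its non-empty closed invariant
  subsets, so it is non-empty.\<close>

locale minimal_system = dynamical_system +
  assumes nonempty: "topspace X \<noteq> {}"
    and minimal: "\<lbrakk>closedin X C; C \<noteq> {}; \<forall>g\<in>carrier G. \<alpha> g ` C \<subseteq> C\<rbrakk> \<Longrightarrow> C = topspace X"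

definition factor_map ::
  "('g, 'm) monoid_scheme \<Rightarrow> 'x topology \<Rightarrow> ('g \<Rightarrow> 'x \<Rightarrow> 'x) \<Rightarrow>
   'y topology \<Rightarrow> ('g \<Rightarrow> 'y \<Rightarrow> 'y) \<Rightarrow> ('x \<Rightarrow> 'y) \<Rightarrow> bool" where
  "factor_map G X \<alpha> Y \<beta> \<pi> \<longleftrightarrow>
     continuous_map X Y \<pi> \<and> \<pi> ` topspace X = topspace Y \<and>
     (\<forall>g\<in>carrier G. \<forall>x\<in>topspace X. \<pi> (\<alpha> g x) = \<beta> g (\<pi> x))"

definition fiber_has_size :: "'x topology \<Rightarrow> ('x \<Rightarrow> 'y) \<Rightarrow> nat \<Rightarrow> 'y \<Rightarrow> bool" where
  "fiber_has_size X \<pi> n y \<longleftrightarrow>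
     finite {x \<in> topspace X. \<pi> x = y} \<and> card {x \<in> topspace X. \<pi> x = y} = n"

definition free_points ::
  "('g, 'm) monoid_scheme \<Rightarrow> 'x topology \<Rightarrow> ('g \<Rightarrow> 'x \<Rightarrow> 'x) \<Rightarrow> 'x set" where
  "free_points G X \<alpha> = {x \<in> topspace X. stabilizer G \<alpha> x = {\<one>\<^bsub>G\<^esub>}}"

text \<open>\<open>conj_stab_points G H Y \<beta>\<close> is the set \<open>Y\<^sub>H\<close> of points whose stabilizer is a conjugate of \<open>H\<close>.\<close>

definition conj_stab_points ::
  "('g, 'm) monoid_scheme \<Rightarrow> 'g set \<Rightarrow> 'y topology \<Rightarrow> ('g \<Rightarrow> 'y \<Rightarrow> 'y) \<Rightarrow> 'y set" where
  "conj_stab_points G H Y \<beta> = {y \<in> topspace Y. stabilizer G \<beta> y \<in> conjugates G H}"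

definition residual_in :: "'x topology \<Rightarrow> 'x set \<Rightarrow> bool" where
  "residual_in X S \<longleftrightarrow> S \<subseteq> topspace X \<and>
     (\<exists>\<U>. countable \<U> \<and> (\<forall>U\<in>\<U>. openin X U \<and> X closure_of U = topspace X) \<and>
          topspace X \<inter> \<Inter>\<U> \<subseteq> S)"

definition topologically_free ::
  "('g, 'm) monoid_scheme \<Rightarrow> 'x topology \<Rightarrow> ('g \<Rightarrow> 'x \<Rightarrow> 'x) \<Rightarrow> bool" where
  "topologically_free G X \<alpha> \<longleftrightarrow> residual_in X (free_points G X \<alpha>)"

definition trivial_holonomy ::
  "('g, 'm) monoid_scheme \<Rightarrow> 'y topology \<Rightarrow> ('g \<Rightarrow> 'y \<Rightarrow> 'y) \<Rightarrow> 'y \<Rightarrow> bool" where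
  "trivial_holonomy G Y \<beta> y \<longleftrightarrow>
     (\<forall>g\<in>stabilizer G \<beta> y. \<exists>U. openin Y U \<and> y \<in> U \<and> (\<forall>z\<in>U. \<beta> g z = z))"

text \<open>Diameter with respect to an explicit distance function, as \<^const>\<open>diameter\<close> for the
  type-class distance. The supremum is only meaningful for bounded sets; it is used below for
  metrics inducing a compact topology.\<close>

definition set_diameter :: "('y \<Rightarrow> 'y \<Rightarrow> real) \<Rightarrow> 'y set \<Rightarrow> real" where
  "set_diameter d U = (if U = {} then 0 else SUP (x, y) \<in> U \<times> U. d x y)"

definition compatible_metric :: "'y topology \<Rightarrow> ('y \<Rightarrow> 'y \<Rightarrow> real) \<Rightarrow> bool" where
  "compatible_metric Y d \<longleftrightarrow>
     Metric_space (topspace Y) d \<and> Metric_space.mtopology (topspace Y) d = Y"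

definition locally_quasi_analytic ::
  "('g, 'm) monoid_scheme \<Rightarrow> 'y topology \<Rightarrow> ('g \<Rightarrow> 'y \<Rightarrow> 'y) \<Rightarrow> ('y \<Rightarrow> 'y \<Rightarrow> real) \<Rightarrow> bool" where
  "locally_quasi_analytic G Y \<beta> d \<longleftrightarrow>
     (\<exists>\<epsilon>>0. \<forall>U g. openin Y U \<and> set_diameter d U < \<epsilon> \<and> g \<in> carrier G \<longrightarrow>
        (\<exists>V. openin Y V \<and> V \<noteq> {} \<and> V \<subseteq> U \<and> (\<forall>z\<in>V. \<beta> g z = z)) \<longrightarrow>
        (\<forall>z\<in>U. \<beta> g z = z))"

section \<open>The space of subgroups\<close>

definition chabauty :: "('g, 'm) monoid_scheme \<Rightarrow> 'g set topology" where
  "chabauty G = topology_generated_by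
     {{K. subgroup K G \<and> A \<subseteq> K \<and> B \<inter> K = {}} | A B.
        finite A \<and> finite B \<and> A \<subseteq> carrier G \<and> B \<subseteq> carrier G}"

definition stabilizer_URS ::
  "('g, 'm) monoid_scheme \<Rightarrow> 'y topology \<Rightarrow> ('g \<Rightarrow> 'y \<Rightarrow> 'y) \<Rightarrow> 'g set set" where
  "stabilizer_URS G Y \<beta> =
     chabauty G closure_of {stabilizer G \<beta> y | y. y \<in> topspace Y \<and> trivial_holonomy G Y \<beta> y}"

section \<open>Measures\<close>

definition borel_of :: "'x topology \<Rightarrow> 'x measure" where
  "borel_of X = sigma (topspace X) {U. openin X U}"

definition invariant_measure ::
  "('g, 'm) monoid_scheme \<Rightarrow> 'x topology \<Rightarrow> ('g \<Rightarrow> 'x \<Rightarrow> 'x) \<Rightarrow> 'x measure \<Rightarrow> bool" where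
  "invariant_measure G X \<alpha> \<mu> \<longleftrightarrow>
     sets \<mu> = sets (borel_of X) \<and> prob_space \<mu> \<and> (\<forall>g\<in>carrier G. distr \<mu> \<mu> (\<alpha> g) = \<mu>)"

definition ergodic_measure ::
  "('g, 'm) monoid_scheme \<Rightarrow> 'x topology \<Rightarrow> ('g \<Rightarrow> 'x \<Rightarrow> 'x) \<Rightarrow> 'x measure \<Rightarrow> bool" where
  "ergodic_measure G X \<alpha> \<mu> \<longleftrightarrow>
     invariant_measure G X \<alpha> \<mu> \<and>
     (\<forall>A\<in>sets \<mu>. (\<forall>g\<in>carrier G. \<alpha> g ` A = A) \<longrightarrow> measure \<mu> A = 0 \<or> measure \<mu> A = 1)"

definition essentially_free ::
  "('g, 'm) monoid_scheme \<Rightarrow> ('g \<Rightarrow> 'x \<Rightarrow> 'x) \<Rightarrow> 'x measure \<Rightarrow> bool" where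
  "essentially_free G \<alpha> \<mu> \<longleftrightarrow> (AE x in \<mu>. stabilizer G \<alpha> x = {\<one>\<^bsub>G\<^esub>})"

definition no_essential_holonomy ::
  "('g, 'm) monoid_scheme \<Rightarrow> 'y topology \<Rightarrow> ('g \<Rightarrow> 'y \<Rightarrow> 'y) \<Rightarrow> 'y measure \<Rightarrow> bool" where
  "no_essential_holonomy G Y \<beta> \<nu> \<longleftrightarrow> (AE y in \<nu>. trivial_holonomy G Y \<beta> y)"

definition stabilizer_IRS ::
  "('g, 'm) monoid_scheme \<Rightarrow> ('g \<Rightarrow> 'y \<Rightarrow> 'y) \<Rightarrow> 'y measure \<Rightarrow> 'g set measure" where
  "stabilizer_IRS G \<beta> \<nu> = distr \<nu> (borel_of (chabauty G)) (stabilizer G \<beta>)"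

section \<open>Factors with stabilizers conjugate to a given subgroup\<close>

definition conj_stab_factor ::
  "('g, 'm) monoid_scheme \<Rightarrow> 'x topology \<Rightarrow> ('g \<Rightarrow> 'x \<Rightarrow> 'x) \<Rightarrow> 'g set \<Rightarrow>
   'y topology \<Rightarrow> ('g \<Rightarrow> 'y \<Rightarrow> 'y) \<Rightarrow> ('x \<Rightarrow> 'y) \<Rightarrow> bool" where
  "conj_stab_factor G X \<alpha> H Y \<beta> \<pi> \<longleftrightarrow>
     minimal_system G Y \<beta> \<and> factor_map G X \<alpha> Y \<beta> \<pi> \<and>
     (\<forall>y\<in>topspace Y. fiber_has_size X \<pi> (card H) y) \<and>
     {x \<in> topspace X. \<pi> x \<in> conj_stab_points G H Y \<beta>} = free_points G X \<alpha>"

definition ae_conj_stab_factor ::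
  "('g, 'm) monoid_scheme \<Rightarrow> 'x topology \<Rightarrow> ('g \<Rightarrow> 'x \<Rightarrow> 'x) \<Rightarrow> 'x measure \<Rightarrow> 'g set \<Rightarrow>
   'y topology \<Rightarrow> ('g \<Rightarrow> 'y \<Rightarrow> 'y) \<Rightarrow> ('x \<Rightarrow> 'y) \<Rightarrow> bool" where
  "ae_conj_stab_factor G X \<alpha> \<mu> H Y \<beta> \<pi> \<longleftrightarrow>
     minimal_system G Y \<beta> \<and> factor_map G X \<alpha> Y \<beta> \<pi> \<and>
     (AE y in distr \<mu> (borel_of Y) \<pi>. fiber_has_size X \<pi> (card H) y) \<and>
     measure (distr \<mu> (borel_of Y) \<pi>) (conj_stab_points G H Y \<beta>) = 1"

definition factors_onto_cosets ::
  "('g, 'm) monoid_scheme \<Rightarrow> 'x topology \<Rightarrow> ('g \<Rightarrow> 'x \<Rightarrow> 'x) \<Rightarrow> 'g set \<Rightarrow> bool" where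
  "factors_onto_cosets G X \<alpha> K \<longleftrightarrow>
     (\<exists>\<phi>. factor_map G X \<alpha> (discrete_topology (lcosets\<^bsub>G\<^esub> K)) (coset_action G K) \<phi>)"

end

theory Submission
  imports Defs "HOL-Analysis.Urysohn"
begin

text \<open>Let \<open>\<C>\<close> be the set of conjugates of \<open>H\<close>. It is finite if and only if \<open>H\<close> is almost normal,
and \<open>g N\<^sub>G(H) \<mapsto> g H g\<^sup>-\<^sup>1\<close> is an equivariant bijection from \<open>G / N\<^sub>G(H)\<close> to \<open>\<C>\<close>. A factor map
\<open>X \<rightarrow> G / N\<^sub>G(H)\<close> is therefore the same as a locally constant equivariant map \<open>L\<close> from \<open>X\<close> to \<open>\<C>\<close>
(\<open>factors_onto_cosets_iff\<close>).

The main use of minimality is the following (\<open>fixed_by_finite_invariant_family\<close>): for a finite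
conjugation-invariant family of subsets of \<open>G\<close>, the points whose stabilizer contains a member of
the family form a closed invariant set, hence none or all of the space. This is applied to three families.

From a map \<open>L\<close> and a free point to a factor: with the family of singletons of non-trivial elements of members of \<open>\<C>\<close>,
the free point shows that these elements have no fixed points anywhere
(\<open>conjugate_element_acts_freely\<close>). Identifying \<open>x\<close> with \<open>k x\<close> for all \<open>k \<in> L x\<close> then gives a quotient
with fibers of size \<open>card H\<close>; it is Hausdorff because \<open>L\<close> takes finitely many values and \<open>H\<close> is
finite, so that the quotient map is closed. The stabilizer of the class of \<open>x\<close> is \<open>L x\<close> times the stabilizer of
\<open>x\<close>, and it is a member of \<open>\<C>\<close> exactly if \<open>x\<close> is free (\<open>conj_stab_factor_L_orbit\<close>).

From a factor \<open>Y\<close> to a map \<open>L\<close>: assume that \<open>\<C>\<close> is finite and that some point of \<open>Y\<close> has its stabilizer in \<open>\<C>\<close>.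
With the family \<open>\<C>\<close>, every stabilizer in \<open>Y\<close> contains a member of \<open>\<C>\<close>; with the family of unions of two
distinct members of \<open>\<C>\<close>, it contains only one, because a member of \<open>\<C>\<close> cannot contain two others of
its size. The corresponding fixed point sets form a finite clopen partition of \<open>Y\<close>, on which \<open>G\<close>
acts as on \<open>\<C>\<close> (\<open>factor_map_conjugate_at\<close>), and this pulls back to \<open>X\<close>. Points with stabilizer in \<open>\<C>\<close> are
dense, so an element that is trivial on a non-empty open subset of a part of the partition belongs to
the conjugate of \<open>H\<close> fixing that part. Hence the points of trivial holonomy are those with
stabilizer in \<open>\<C>\<close>, the stabilizer URS is \<open>\<C>\<close>, and local quasi-analyticity holds with a Lebesgue number of the
partition.

Topological freeness provides a free point by Baire category, and essential freeness provides one by measure. In the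
measured setting, finiteness of \<open>\<C>\<close> is a conclusion: the sets of points of \<open>Y\<close> with
stabilizer \<open>K\<close>, for \<open>K\<close> in \<open>\<C>\<close>, are disjoint and of equal measure, and their countable union
has measure \<open>1\<close> (\<open>finite_conjugates_of_invariant_measure\<close>).\<close>

section \<open>Conjugates and cosets of the normalizer\<close>

lemma finite_image_iff_same_kernel:
  assumes "\<And>x y. x \<in> A \<Longrightarrow> y \<in> A \<Longrightarrow> f x = f y \<longleftrightarrow> g x = g y"
  shows "finite (f ` A) \<longleftrightarrow> finite (g ` A)"
proof -
  have "finite (v ` A)" if "finite (u ` A)"
    and uv: "\<forall>x\<in>A. \<forall>y\<in>A. u x = u y \<longrightarrow> v x = v y"
    for u :: "'a \<Rightarrow> 'd" and v :: "'a \<Rightarrow> 'e"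
  proof -
    have "v x = (v \<circ> inv_into A u) (u x)" if "x \<in> A" for x
      using that uv by (metis comp_apply f_inv_into_f image_eqI inv_into_into)
    then have "v ` A \<subseteq> (v \<circ> inv_into A u) ` (u ` A)"
      by auto
    then show ?thesis
      using \<open>finite (u ` A)\<close> by (meson finite_imageI finite_subset)
  qed
  from this[of f g] this[of g f] show ?thesis
    using assms by blast
qed

definition conj_by :: "('g, 'm) monoid_scheme \<Rightarrow> 'g \<Rightarrow> 'g set \<Rightarrow> 'g set" where
  "conj_by G g K = (\<lambda>k. g \<otimes>\<^bsub>G\<^esub> k \<otimes>\<^bsub>G\<^esub> inv\<^bsub>G\<^esub> g) ` K"

lemma conj_by_eq_cosets: "conj_by G g K = g <#\<^bsub>G\<^esub> K #>\<^bsub>G\<^esub> inv\<^bsub>G\<^esub> g"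
  by (auto simp: conj_by_def l_coset_def r_coset_def)

lemma conjugates_eq: "conjugates G H = (\<lambda>g. conj_by G g H) ` carrier G"
  by (auto simp: conjugates_def conj_by_eq_cosets)

lemma lcosets_eq: "lcosets\<^bsub>G\<^esub> K = (\<lambda>g. g <#\<^bsub>G\<^esub> K) ` carrier G"
  by (auto simp: LCOSETS_def)

context group
begin

lemma conj_by_subset: "\<lbrakk>g \<in> carrier G; K \<subseteq> carrier G\<rbrakk> \<Longrightarrow> conj_by G g K \<subseteq> carrier G"
  by (auto simp: conj_by_def)

lemma conj_by_one: "K \<subseteq> carrier G \<Longrightarrow> conj_by G \<one> K = K"
  by (auto simp: conj_by_def subset_iff image_iff)

lemma conj_by_mult:
  assumes "g \<in> carrier G" "h \<in> carrier G" "K \<subseteq> carrier G"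
  shows "conj_by G (g \<otimes> h) K = conj_by G g (conj_by G h K)"
  using assms unfolding conj_by_def image_image
  by (intro image_cong) (auto simp: inv_mult_group m_assoc subset_iff)

lemma conj_by_inv_cancel:
  assumes "g \<in> carrier G" "K \<subseteq> carrier G"
  shows "conj_by G (inv g) (conj_by G g K) = K" "conj_by G g (conj_by G (inv g) K) = K"
  using assms conj_by_mult[of "inv g" g K] conj_by_mult[of g "inv g" K]
  by (simp_all add: conj_by_one)

lemma inj_on_conj: "\<lbrakk>g \<in> carrier G; K \<subseteq> carrier G\<rbrakk> \<Longrightarrow> inj_on (\<lambda>k. g \<otimes> k \<otimes> inv g) K"
  by (auto simp: inj_on_def subset_iff)

lemma card_conj_by: "\<lbrakk>g \<in> carrier G; K \<subseteq> carrier G\<rbrakk> \<Longrightarrow> card (conj_by G g K) = card K"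
  by (simp add: conj_by_def card_image inj_on_conj)

lemma subgroup_conj_by: "\<lbrakk>g \<in> carrier G; subgroup K G\<rbrakk> \<Longrightarrow> subgroup (conj_by G g K) G"
  using subgroup_conjugation_is_surj1[of "inv g" K] by (simp add: conj_by_eq_cosets)

lemma conj_by_in_conjugates:
  assumes "H \<subseteq> carrier G" "g \<in> carrier G" "K \<in> conjugates G H"
  shows "conj_by G g K \<in> conjugates G H"
proof -
  obtain a where a: "a \<in> carrier G" "K = conj_by G a H"
    using assms(3) by (auto simp: conjugates_eq)
  then have "conj_by G g K = conj_by G (g \<otimes> a) H"
    using assms by (simp add: conj_by_mult)
  then show ?thesis
    using a assms by (auto simp: conjugates_eq)
qed

lemma conjugates_transitive:
  assumes "H \<subseteq> carrier G" "K \<in> conjugates G H" "K' \<in> conjugates G H"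
  obtains g where "g \<in> carrier G" "K' = conj_by G g K"
proof -
  obtain a b where ab: "a \<in> carrier G" "K = conj_by G a H" "b \<in> carrier G" "K' = conj_by G b H"
    using assms unfolding conjugates_eq by auto
  then have "conj_by G (b \<otimes> inv a) K = K'"
    using assms(1) by (simp add: conj_by_mult conj_by_subset conj_by_inv_cancel)
  then show ?thesis
    using ab that by (metis inv_closed m_closed)
qed

lemma conjugates_subgroup: "\<lbrakk>subgroup H G; K \<in> conjugates G H\<rbrakk> \<Longrightarrow> subgroup K G"
  unfolding conjugates_eq using subgroup_conj_by by auto

lemma conjugates_card: "\<lbrakk>H \<subseteq> carrier G; K \<in> conjugates G H\<rbrakk> \<Longrightarrow> card K = card H"
  unfolding conjugates_eq using card_conj_by by auto

lemma conjugates_finite: "\<lbrakk>finite H; K \<in> conjugates G H\<rbrakk> \<Longrightarrow> finite K"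
  unfolding conjugates_eq by (auto simp: conj_by_def)

lemma conjugates_eqI:
  assumes "H \<subseteq> carrier G" "finite H"
    and "K \<in> conjugates G H" "K' \<in> conjugates G H" "K \<subseteq> K'"
  shows "K = K'"
  using assms conjugates_card[of H] conjugates_finite[of H] by (intro card_subset_eq) auto

lemma normalizer_eq: "H \<subseteq> carrier G \<Longrightarrow> normalizer G H = {g \<in> carrier G. conj_by G g H = H}"
  by (auto simp: normalizer_def stabilizer_def conj_by_eq_cosets)

text \<open>Orbit--stabilizer for the conjugation action: \<open>g N\<^sub>G(H)\<close> is determined by, and determines,
  the conjugate of \<open>H\<close> by \<open>g\<close>.\<close>

lemma normalizer_coset_eq_iff:
  assumes H: "H \<subseteq> carrier G" and g: "g \<in> carrier G" and h: "h \<in> carrier G"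
  shows "g <# normalizer G H = h <# normalizer G H \<longleftrightarrow> conj_by G g H = conj_by G h H"
proof -
  let ?N = "normalizer G H"
  have N: "subgroup ?N G"
    using H by (rule normalizer_imp_subgroup)
  have "g <# ?N = h <# ?N \<longleftrightarrow> inv h \<otimes> g \<in> ?N"
  proof
    assume "g <# ?N = h <# ?N"
    then have "g \<in> h <# ?N"
      using lcos_self[OF g N] by simp
    then show "inv h \<otimes> g \<in> ?N"
      using subgroup.lcos_module_imp[OF N is_group h] by simp
  next
    assume "inv h \<otimes> g \<in> ?N"
    then have "g \<in> h <# ?N"
      using subgroup.lcos_module_rev[OF N is_group h g] by simp
    then show "g <# ?N = h <# ?N"
      using l_repr_independence[OF _ h N] by metis
  qed
  also have "\<dots> \<longleftrightarrow> conj_by G (inv h) (conj_by G g H) = H"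
    using assms by (simp add: normalizer_eq conj_by_mult)
  also have "\<dots> \<longleftrightarrow> conj_by G g H = conj_by G h H"
    using assms conj_by_inv_cancel conj_by_subset by metis
  finally show ?thesis .
qed

lemma almost_normal_iff_finite_conjugates:
  assumes "subgroup H G"
  shows "almost_normal G H \<longleftrightarrow> finite (conjugates G H)"
proof -
  show ?thesis
    unfolding almost_normal_def conjugates_eq lcosets_eq
    using finite_image_iff_same_kernel[OF normalizer_coset_eq_iff, OF subgroup.subset[OF assms]] assms
    by simp
qed

text \<open>The \<open>G\<close>-equivariant bijection between \<open>G / N\<^sub>G(H)\<close> and the conjugates of \<open>H\<close>.\<close>

definition conjugate_of_coset :: "'a set \<Rightarrow> 'a set \<Rightarrow> 'a set" where
  "conjugate_of_coset H C = conj_by G (SOME g. g \<in> carrier G \<and> C = g <# normalizer G H) H"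

lemma conjugate_of_coset:
  assumes "H \<subseteq> carrier G" "g \<in> carrier G"
  shows "conjugate_of_coset H (g <# normalizer G H) = conj_by G g H"
proof -
  define h where "h = (SOME h. h \<in> carrier G \<and> g <# normalizer G H = h <# normalizer G H)"
  have "h \<in> carrier G \<and> g <# normalizer G H = h <# normalizer G H"
    unfolding h_def by (rule someI[of _ g]) (simp add: assms)
  then show ?thesis
    unfolding conjugate_of_coset_def h_def[symmetric] using assms normalizer_coset_eq_iff by blast
qed

lemma bij_betw_conjugate_of_coset:
  assumes "H \<subseteq> carrier G"
  shows "bij_betw (conjugate_of_coset H) (lcosets (normalizer G H)) (conjugates G H)"
proof (rule bij_betw_imageI)
  show "inj_on (conjugate_of_coset H) (lcosets (normalizer G H))"
    using assms normalizer_coset_eq_iff by (auto simp: inj_on_def LCOSETS_def conjugate_of_coset)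
  show "conjugate_of_coset H ` (lcosets (normalizer G H)) = conjugates G H"
    unfolding lcosets_eq conjugates_eq image_image using assms by (simp add: conjugate_of_coset)
qed

lemma l_coset_in_lcosets:
  assumes "K \<subseteq> carrier G" "g \<in> carrier G" "C \<in> lcosets K"
  shows "g <# C \<in> lcosets K"
  using assms by (auto simp: LCOSETS_def lcos_m_assoc)

lemma conjugate_of_coset_translate:
  assumes "subgroup H G" "g \<in> carrier G" "C \<in> lcosets (normalizer G H)"
  shows "conjugate_of_coset H (g <# C) = conj_by G g (conjugate_of_coset H C)"
proof -
  have H: "H \<subseteq> carrier G" 
    using assms(1) by (rule subgroup.subset)
  have N: "normalizer G H \<subseteq> carrier G"
    using H by (auto simp: normalizer_eq)
  show ?thesis
    using assms(2,3) H N by (auto simp: LCOSETS_def lcos_m_assoc conjugate_of_coset conj_by_mult)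
qed

end

section \<open>Factors onto coset spaces\<close>

lemma factor_map_compose:
  assumes "factor_map G X \<alpha> Y \<beta> \<pi>" "factor_map G Y \<beta> Z \<gamma> \<phi>"
  shows "factor_map G X \<alpha> Z \<gamma> (\<phi> \<circ> \<pi>)"
proof -
  have \<pi>: "continuous_map X Y \<pi>" "\<pi> ` topspace X = topspace Y"
    and "\<phi> ` topspace Y = topspace Z" "continuous_map Y Z \<phi>"
    and "\<And>g x. \<lbrakk>g \<in> carrier G; x \<in> topspace X\<rbrakk> \<Longrightarrow> \<pi> (\<alpha> g x) = \<beta> g (\<pi> x)"
    and "\<And>g y. \<lbrakk>g \<in> carrier G; y \<in> topspace Y\<rbrakk> \<Longrightarrow> \<phi> (\<beta> g y) = \<gamma> g (\<phi> y)"
    using assms by (simp_all add: factor_map_def)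
  moreover have "\<pi> x \<in> topspace Y" if "x \<in> topspace X" for x
    using \<pi>(2) that by blast
  moreover have "(\<phi> \<circ> \<pi>) ` topspace X = \<phi> ` \<pi> ` topspace X"
    by (rule image_comp[symmetric])
  ultimately show ?thesis
    unfolding factor_map_def by (simp add: continuous_map_compose)
qed

lemma factor_map_discreteI:
  assumes "f ` A = B" and "\<And>g c. \<lbrakk>g \<in> carrier G; c \<in> A\<rbrakk> \<Longrightarrow> f (a g c) = b g (f c)"
  shows "factor_map G (discrete_topology A) a (discrete_topology B) b f"
  using assms by (auto simp: factor_map_def)

text \<open>Factors onto \<open>G / N\<^sub>G(H)\<close> are handled through this reformulation: such a factor map amounts to a
locally constant equivariant choice of a conjugate of \<open>H\<close> at every point.\<close>

lemma factors_onto_cosets_iff: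
  fixes G (structure)
  assumes "group G" and H: "subgroup H G"
  shows "factors_onto_cosets G X \<alpha> (normalizer G H) \<longleftrightarrow>
    (\<exists>L. factor_map G X \<alpha> (discrete_topology (conjugates G H)) (conj_by G) L)"
proof -
  interpret group G by fact
  let ?A = "lcosets (normalizer G H)" and ?f = "conjugate_of_coset H"
  have N: "normalizer G H \<subseteq> carrier G"
    by (auto simp: normalizer_eq subgroup.subset[OF H])
  note bij = bij_betw_conjugate_of_coset[OF subgroup.subset[OF H]]
  have act: "coset_action G (normalizer G H) g C = g <# C" if "C \<in> ?A" for g C
    using that by (simp add: coset_action_def)
  have f: "?f (coset_action G (normalizer G H) g C) = conj_by G g (?f C)"
    if "g \<in> carrier G" "C \<in> ?A" for g C
    using that by (simp add: act conjugate_of_coset_translate[OF H])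
  have finv: "inv_into ?A ?f (conj_by G g K) = coset_action G (normalizer G H) g (inv_into ?A ?f K)"
    if g: "g \<in> carrier G" and K: "K \<in> conjugates G H" for g K
  proof -
    obtain C where C: "C \<in> ?A" "K = ?f C"
      using bij K unfolding bij_betw_def by blast
    have "g <# C \<in> ?A"
      using l_coset_in_lcosets[OF N g C(1)] .
    then have "inv_into ?A ?f (?f (g <# C)) = g <# C" "inv_into ?A ?f (?f C) = C"
      using bij C(1) by (auto simp: bij_betw_def inv_into_f_f)
    then show ?thesis
      using C g by (simp add: act conjugate_of_coset_translate[OF H])
  qed
  show ?thesis
  proof
    assume "factors_onto_cosets G X \<alpha> (normalizer G H)"
    then obtain \<phi> where \<phi>: "factor_map G X \<alpha> (discrete_topology ?A)
        (coset_action G (normalizer G H)) \<phi>"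
      by (auto simp: factors_onto_cosets_def)
    show "\<exists>L. factor_map G X \<alpha> (discrete_topology (conjugates G H)) (conj_by G) L"
      by (rule exI, rule factor_map_compose[OF \<phi> factor_map_discreteI[OF bij_betw_imp_surj_on[OF bij]]]) (rule f)
  next
    assume "\<exists>L. factor_map G X \<alpha> (discrete_topology (conjugates G H)) (conj_by G) L"
    then obtain L where L: "factor_map G X \<alpha> (discrete_topology (conjugates G H)) (conj_by G) L"
      by blast
    show "factors_onto_cosets G X \<alpha> (normalizer G H)"
      unfolding factors_onto_cosets_def
      by (rule exI, rule factor_map_compose[OF L factor_map_discreteI[OF bij_betw_imp_surj_on[OF bij_betw_inv_into[OF bij]]]])
         (rule finv)
  qed
qed

section \<open>Stabilizers in dynamical systems\<close>

context dynamical_system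
begin

sublocale group G
  using group_hom by (rule group_hom.axioms(1))

lemma act_in: "\<lbrakk>g \<in> carrier G; x \<in> topspace X\<rbrakk> \<Longrightarrow> \<alpha> g x \<in> topspace X"
  using element_image by blast

lemma act_one: "x \<in> topspace X \<Longrightarrow> \<alpha> \<one> x = x"
  using id_eq_one by (metis restrict_apply')

lemma act_inv:
  assumes "g \<in> carrier G" "x \<in> topspace X"
  shows "\<alpha> (inv g) (\<alpha> g x) = x" "\<alpha> g (\<alpha> (inv g) x) = x"
  using assms composition_rule[of x "inv g" g] composition_rule[of x g "inv g"]
  by (simp_all add: act_one)

lemma stabilizer_carrier: "stabilizer G \<alpha> x \<subseteq> carrier G"
  by (auto simp: stabilizer_def)

lemma conj_by_subset_stabilizer:
  assumes "g \<in> carrier G" "x \<in> topspace X" "K \<subseteq> stabilizer G \<alpha> x"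
  shows "conj_by G g K \<subseteq> stabilizer G \<alpha> (\<alpha> g x)"
proof
  fix k assume "k \<in> conj_by G g K"
  then obtain h where h: "h \<in> K" "k = g \<otimes> h \<otimes> inv g"
    by (auto simp: conj_by_def)
  then have "h \<in> carrier G" "\<alpha> h x = x"
    using assms by (auto simp: stabilizer_def)
  then show "k \<in> stabilizer G \<alpha> (\<alpha> g x)"
    using h assms by (simp add: stabilizer_def composition_rule act_in act_inv)
qed

lemma stabilizer_act:
  assumes g: "g \<in> carrier G" and x: "x \<in> topspace X"
  shows "stabilizer G \<alpha> (\<alpha> g x) = conj_by G g (stabilizer G \<alpha> x)"
proof
  have "conj_by G (inv g) (stabilizer G \<alpha> (\<alpha> g x)) \<subseteq> stabilizer G \<alpha> x"
    using conj_by_subset_stabilizer[of "inv g" "\<alpha> g x"] g x by (simp add: act_in act_inv)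
  then have "conj_by G g (conj_by G (inv g) (stabilizer G \<alpha> (\<alpha> g x))) \<subseteq> conj_by G g (stabilizer G \<alpha> x)"
    unfolding conj_by_def by blast
  then show "stabilizer G \<alpha> (\<alpha> g x) \<subseteq> conj_by G g (stabilizer G \<alpha> x)"
    using g stabilizer_carrier by (simp add: conj_by_inv_cancel)
qed (use conj_by_subset_stabilizer g x in blast)

lemma continuous_act: "g \<in> carrier G \<Longrightarrow> continuous_map X X (\<alpha> g)"
  using homeo homeomorphic_imp_continuous_map by blast

lemma closedin_fixed_by:
  assumes "K \<subseteq> carrier G"
  shows "closedin X {x \<in> topspace X. K \<subseteq> stabilizer G \<alpha> x}"
proof -
  have "closedin X {x \<in> topspace X. \<alpha> k x = x}" if "k \<in> K" for k
  proof -
    have "closedin X {x \<in> topspace X. \<alpha> k x = id x}"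
      using assms that Hausdorff continuous_act
      by (intro closedin_continuous_maps_eq[OF Hausdorff]) auto
    then show ?thesis by simp
  qed
  moreover have "{x \<in> topspace X. K \<subseteq> stabilizer G \<alpha> x} =
      topspace X \<inter> (\<Inter>k\<in>K. {x \<in> topspace X. \<alpha> k x = x})"
    using assms by (auto simp: stabilizer_def)
  ultimately show ?thesis
    by (cases "K = {}") (auto intro!: closedin_Int closedin_Inter)
qed

text \<open>A residual subset of a non-empty compact Hausdorff space is non-empty, by the Baire category theorem.\<close>

lemma free_point_of_topologically_free:
  assumes "topologically_free G X \<alpha>" "topspace X \<noteq> {}"
  shows "free_points G X \<alpha> \<noteq> {}"
proof -
  obtain \<U> where \<U>: "countable \<U>" "\<And>U. U \<in> \<U> \<Longrightarrow> openin X U \<and> X closure_of U = topspace X"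
    "topspace X \<inter> \<Inter>\<U> \<subseteq> free_points G X \<alpha>"
    using assms(1) unfolding topologically_free_def residual_in_def by metis
  have "locally_compact_space X" "regular_space X"
    using compact Hausdorff
    by (simp_all add: compact_Hausdorff_imp_regular_space compact_imp_locally_compact_space)
  then have "X closure_of \<Inter>\<U> = topspace X"
    using \<U> by (intro Baire_category) auto
  then have "topspace X \<inter> \<Inter>\<U> \<noteq> {}"
    using assms(2) by (metis closure_of_restrict closure_of_empty)
  then show ?thesis
    using \<U>(3) by blast
qed

end

context minimal_system
begin

lemma closed_invariant_eq_topspace:
  assumes "closedin X C" "C \<noteq> {}" "\<And>g x. \<lbrakk>g \<in> carrier G; x \<in> C\<rbrakk> \<Longrightarrow> \<alpha> g x \<in> C"
  shows "C = topspace X"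
  using assms by (intro minimal) auto

text \<open>The points whose orbit misses \<open>U\<close> form a closed invariant set, and it is not the whole space.\<close>

lemma orbit_meets_open:
  assumes x: "x \<in> topspace X" and U: "openin X U" "U \<noteq> {}"
  obtains g where "g \<in> carrier G" "\<alpha> g x \<in> U"
proof -
  define C where "C = topspace X - (\<Union>g\<in>carrier G. {z \<in> topspace X. \<alpha> g z \<in> U})"
  have "closedin X C"
    unfolding C_def using continuous_act U(1)
    by (intro closedin_diff closedin_topspace openin_Union)
       (auto intro: openin_continuous_map_preimage)
  moreover have "\<alpha> h z \<in> C" if h: "h \<in> carrier G" and z: "z \<in> C" for h z
  proof -
    have "\<alpha> g (\<alpha> h z) \<notin> U" if "g \<in> carrier G" for g
    proof -
      have "z \<in> topspace X" "\<alpha> (g \<otimes> h) z \<notin> U"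
        using m_closed[OF that h] z unfolding C_def by blast+
      then show ?thesis
        using that h by (simp add: composition_rule)
    qed
    then show ?thesis
      using h z by (auto simp: C_def act_in)
  qed
  moreover have "C \<noteq> topspace X"
  proof -
    obtain z where z: "z \<in> U" "z \<in> topspace X"
      using U openin_subset by blast
    then have "z \<notin> C"
      unfolding C_def using act_one[OF z(2)] by (auto intro!: bexI[of _ "\<one>"])
    then show ?thesis
      using z by blast
  qed
  ultimately have "C = {}"
    using closed_invariant_eq_topspace by blast
  then show ?thesis
    using x that unfolding C_def by blast
qed

text \<open>Fixing all of \<open>K\<close> is a closed condition, and acting by \<open>g\<close>
turns it into the condition for the conjugate of \<open>K\<close> by \<open>g\<close>. So the points whose stabilizer contains some
member of \<open>\<K>\<close> form a closed (by finiteness) and invariant set, which minimality makes empty or everything.\<close>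

lemma fixed_by_finite_invariant_family:
  assumes fin: "finite \<K>" and sub: "\<And>K. K \<in> \<K> \<Longrightarrow> K \<subseteq> carrier G"
    and inv: "\<And>g K. \<lbrakk>g \<in> carrier G; K \<in> \<K>\<rbrakk> \<Longrightarrow> conj_by G g K \<in> \<K>"
    and x: "x \<in> topspace X" "K \<in> \<K>" "K \<subseteq> stabilizer G \<alpha> x" and y: "y \<in> topspace X"
  obtains K' where "K' \<in> \<K>" "K' \<subseteq> stabilizer G \<alpha> y"
proof -
  define C where "C = (\<Union>K\<in>\<K>. {x \<in> topspace X. K \<subseteq> stabilizer G \<alpha> x})"
  have "closedin X C"
    unfolding C_def using fin sub closedin_fixed_by by (intro closedin_Union) auto
  moreover have "\<alpha> g z \<in> C" if g: "g \<in> carrier G" and z: "z \<in> C" for g z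
  proof -
    obtain K where K: "K \<in> \<K>" "z \<in> topspace X" "K \<subseteq> stabilizer G \<alpha> z"
      using z by (auto simp: C_def)
    then have "conj_by G g K \<in> \<K>" "conj_by G g K \<subseteq> stabilizer G \<alpha> (\<alpha> g z)"
      using g inv conj_by_subset_stabilizer by auto
    then show ?thesis
      using g K(2) act_in by (auto simp: C_def)
  qed
  moreover have "C \<noteq> {}"
    using x by (auto simp: C_def)
  ultimately have "C = topspace X"
    using closed_invariant_eq_topspace by blast
  then show ?thesis
    using y that by (auto simp: C_def)
qed

text \<open>Surjectivity comes for free, since \<open>G\<close> permutes the conjugates of \<open>H\<close> transitively.\<close>

lemma factor_map_conjugatesI:
  assumes H: "subgroup H G"
    and L: "\<And>x. x \<in> topspace X \<Longrightarrow> L x \<in> conjugates G H"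
    and op: "\<And>K. K \<in> conjugates G H \<Longrightarrow> openin X {x \<in> topspace X. L x = K}"
    and eq: "\<And>g x. \<lbrakk>g \<in> carrier G; x \<in> topspace X\<rbrakk> \<Longrightarrow> L (\<alpha> g x) = conj_by G g (L x)"
  shows "factor_map G X \<alpha> (discrete_topology (conjugates G H)) (conj_by G) L"
proof -
  have "openin X {x \<in> topspace X. L x \<in> U}" if "U \<subseteq> conjugates G H" for U
  proof -
    have "{x \<in> topspace X. L x \<in> U} = (\<Union>K\<in>U. {x \<in> topspace X. L x = K})"
      by auto
    then show ?thesis
      using op that by (auto intro!: openin_Union)
  qed
  moreover have "K \<in> L ` topspace X" if K: "K \<in> conjugates G H" for K
  proof -
    obtain x where x: "x \<in> topspace X"
      using nonempty by blast
    then obtain g where "g \<in> carrier G" "K = conj_by G g (L x)"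
      using conjugates_transitive[OF subgroup.subset[OF H] L[OF x] K] by metis
    then show ?thesis
      using x eq act_in by (metis image_eqI)
  qed
  ultimately show ?thesis
    using L eq by (auto simp: factor_map_def continuous_map_def)
qed

end

section \<open>Systems with a stabilizer conjugate to a finite almost normal subgroup\<close>

locale conjugate_stabilizer_system = minimal_system G Y \<beta>
  for G :: "('g, 'm) monoid_scheme" (structure)
    and Y :: "'y topology" and \<beta> :: "'g \<Rightarrow> 'y \<Rightarrow> 'y" +
  fixes H :: "'g set"
  assumes subgroup_H: "subgroup H G" and finite_H: "finite H"
    and finite_conjugates: "finite (conjugates G H)"
    and conj_stab_point: "conj_stab_points G H Y \<beta> \<noteq> {}"
begin

lemma H_subset: "H \<subseteq> carrier G"
  using subgroup_H by (rule subgroup.subset)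

lemma conjugate_subset: "K \<in> conjugates G H \<Longrightarrow> K \<subseteq> carrier G"
  using conjugates_subgroup[OF subgroup_H] subgroup.subset by blast

text \<open>The family of all conjugates of \<open>H\<close> is finite and invariant, and at the given point of
\<open>Y\<^sub>H\<close> one of its members is contained in the stabilizer.\<close>

lemma ex_conjugate_in_stabilizer:
  assumes "y \<in> topspace Y"
  shows "\<exists>K \<in> conjugates G H. K \<subseteq> stabilizer G \<beta> y"
proof -
  obtain y0 where "y0 \<in> topspace Y" "stabilizer G \<beta> y0 \<in> conjugates G H"
    using conj_stab_point by (auto simp: conj_stab_points_def)
  then show ?thesis
    using assms fixed_by_finite_invariant_family[OF finite_conjugates conjugate_subset
        conj_by_in_conjugates[OF H_subset]]
    by (metis subset_refl)
qed

text \<open>The unions of two distinct conjugates form another finite invariant family. If one of them were contained in the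
stabilizer of some point, this would happen at every point, in particular at a point of
\<open>Y\<^sub>H\<close>. But there the stabilizer is itself a conjugate of \<open>H\<close>, so it is finite of the same size as the two
conjugates that it contains and equal to both.\<close>

lemma conjugate_in_stabilizer_unique:
  assumes y: "y \<in> topspace Y" and K: "K \<in> conjugates G H" "K \<subseteq> stabilizer G \<beta> y"
    and K': "K' \<in> conjugates G H" "K' \<subseteq> stabilizer G \<beta> y"
  shows "K = K'"
proof (rule ccontr)
  assume "K \<noteq> K'"
  define \<K> where "\<K> = {A \<union> B | A B. A \<in> conjugates G H \<and> B \<in> conjugates G H \<and> A \<noteq> B}"
  have "\<K> \<subseteq> (\<lambda>(A, B). A \<union> B) ` (conjugates G H \<times> conjugates G H)"
    by (auto simp: \<K>_def)
  then have fin: "finite \<K>"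
    using finite_conjugates by (meson finite_SigmaI finite_imageI finite_subset)
  have sub: "A \<subseteq> carrier G" if "A \<in> \<K>" for A
    using that conjugate_subset by (auto simp: \<K>_def)
  have inv: "conj_by G g C \<in> \<K>" if g: "g \<in> carrier G" and C: "C \<in> \<K>" for g C
  proof -
    obtain A B where AB: "C = A \<union> B" "A \<in> conjugates G H" "B \<in> conjugates G H" "A \<noteq> B"
      using C by (auto simp: \<K>_def)
    then have "conj_by G g A \<noteq> conj_by G g B"
      using g conj_by_inv_cancel(1) conjugate_subset by metis
    moreover have "conj_by G g C = conj_by G g A \<union> conj_by G g B"
      using AB(1) by (auto simp: conj_by_def)
    moreover have "conj_by G g A \<in> conjugates G H" "conj_by G g B \<in> conjugates G H"
      using AB g conj_by_in_conjugates[OF H_subset] by blast+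
    ultimately show ?thesis
      unfolding \<K>_def by blast
  qed
  have KK': "K \<union> K' \<in> \<K>" "K \<union> K' \<subseteq> stabilizer G \<beta> y"
    using K K' \<open>K \<noteq> K'\<close> by (auto simp: \<K>_def)
  obtain y0 where y0: "y0 \<in> topspace Y" "stabilizer G \<beta> y0 \<in> conjugates G H"
    using conj_stab_point by (auto simp: conj_stab_points_def)
  obtain C where "C \<in> \<K>" "C \<subseteq> stabilizer G \<beta> y0"
    using fixed_by_finite_invariant_family[OF fin sub inv y KK' y0(1)] by blast
  then obtain A B where "A \<in> conjugates G H" "B \<in> conjugates G H" "A \<noteq> B"
    "A \<subseteq> stabilizer G \<beta> y0" "B \<subseteq> stabilizer G \<beta> y0"
    by (auto simp: \<K>_def)
  then show False
    using y0(2) conjugates_eqI[OF H_subset finite_H] by metis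
qed

text \<open>The unique conjugate of \<open>H\<close> fixing the point. Its fibers are the closed sets of points fixed by a
given conjugate; being finitely many and disjoint, they are clopen.\<close>

definition conjugate_at :: "'y \<Rightarrow> 'g set" where
  "conjugate_at y = (THE K. K \<in> conjugates G H \<and> K \<subseteq> stabilizer G \<beta> y)"

lemma conjugate_at:
  assumes "y \<in> topspace Y"
  shows "conjugate_at y \<in> conjugates G H" "conjugate_at y \<subseteq> stabilizer G \<beta> y"
proof -
  have "\<exists>!K. K \<in> conjugates G H \<and> K \<subseteq> stabilizer G \<beta> y"
    using ex_conjugate_in_stabilizer[OF assms] conjugate_in_stabilizer_unique[OF assms] by metis
  from theI'[OF this] show "conjugate_at y \<in> conjugates G H" "conjugate_at y \<subseteq> stabilizer G \<beta> y"
    by (simp_all add: conjugate_at_def)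
qed

lemma conjugate_at_eqI:
  assumes "y \<in> topspace Y" "K \<in> conjugates G H" "K \<subseteq> stabilizer G \<beta> y"
  shows "conjugate_at y = K"
  using assms conjugate_at conjugate_in_stabilizer_unique by metis

lemma openin_conjugate_at:
  assumes K: "K \<in> conjugates G H"
  shows "openin Y {y \<in> topspace Y. conjugate_at y = K}"
proof -
  let ?F = "\<lambda>K. {y \<in> topspace Y. K \<subseteq> stabilizer G \<beta> y}"
  have "{y \<in> topspace Y. conjugate_at y = K} = topspace Y - (\<Union>K'\<in>conjugates G H - {K}. ?F K')"
    using conjugate_at conjugate_at_eqI by fast
  moreover have "closedin Y (\<Union>K'\<in>conjugates G H - {K}. ?F K')"
    using finite_conjugates conjugate_subset closedin_fixed_by by (intro closedin_Union) auto
  ultimately show ?thesis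
    by auto
qed

lemma factor_map_conjugate_at:
  "factor_map G Y \<beta> (discrete_topology (conjugates G H)) (conj_by G) conjugate_at"
proof (rule factor_map_conjugatesI[OF subgroup_H conjugate_at(1) openin_conjugate_at])
  fix g y assume gy: "g \<in> carrier G" "y \<in> topspace Y"
  then show "conjugate_at (\<beta> g y) = conj_by G g (conjugate_at y)"
    using conjugate_at[OF gy(2)] conj_by_in_conjugates[OF H_subset gy(1)]
    by (intro conjugate_at_eqI act_in conj_by_subset_stabilizer) auto
qed

lemma conj_stab_points_dense:
  assumes "openin Y U" "U \<noteq> {}"
  obtains y where "y \<in> U" "y \<in> conj_stab_points G H Y \<beta>"
proof -
  obtain y0 where y0: "y0 \<in> topspace Y" "stabilizer G \<beta> y0 \<in> conjugates G H"
    using conj_stab_point by (auto simp: conj_stab_points_def)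
  obtain g where "g \<in> carrier G" "\<beta> g y0 \<in> U"
    using orbit_meets_open[OF y0(1) assms] .
  moreover from this have "\<beta> g y0 \<in> conj_stab_points G H Y \<beta>"
    using y0 by (simp add: conj_stab_points_def stabilizer_act act_in conj_by_in_conjugates[OF H_subset])
  ultimately show ?thesis
    using that by blast
qed

text \<open>Since \<open>Y\<^sub>H\<close> is dense, the open set \<open>V\<close> contains a point whose stabilizer is exactly
the conjugate \<open>K\<close> of \<open>H\<close> attached to it.\<close>

lemma locally_trivial_in_conjugate:
  assumes g: "g \<in> carrier G" and V: "openin Y V" "V \<noteq> {}" "\<And>z. z \<in> V \<Longrightarrow> \<beta> g z = z"
    and K: "\<And>z. z \<in> V \<Longrightarrow> conjugate_at z = K"
  shows "g \<in> K"
proof -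
  obtain y where y: "y \<in> V" "y \<in> conj_stab_points G H Y \<beta>"
    using conj_stab_points_dense[OF V(1,2)] .
  then have "conjugate_at y = stabilizer G \<beta> y"
    by (intro conjugate_at_eqI) (auto simp: conj_stab_points_def)
  then show ?thesis
    using y(1) g V(3) K by (auto simp: stabilizer_def)
qed

text \<open>At a point of \<open>Y\<^sub>H\<close> every element of the stabilizer fixes the whole clopen fiber of
\<open>conjugate_at\<close>. Conversely, an element fixing a neighborhood already lies in the
conjugate at the point.\<close>

lemma trivial_holonomy_iff:
  assumes y: "y \<in> topspace Y"
  shows "trivial_holonomy G Y \<beta> y \<longleftrightarrow> y \<in> conj_stab_points G H Y \<beta>"
proof
  let ?W = "{z \<in> topspace Y. conjugate_at z = conjugate_at y}"
  have W: "openin Y ?W"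
    using conjugate_at[OF y] openin_conjugate_at by blast
  {
    assume hol: "trivial_holonomy G Y \<beta> y"
    have "g \<in> conjugate_at y" if g: "g \<in> stabilizer G \<beta> y" for g
    proof -
      obtain U where U: "openin Y U" "y \<in> U" "\<forall>z\<in>U. \<beta> g z = z"
        using bspec[OF hol[unfolded trivial_holonomy_def] g] by auto
      show ?thesis
      proof (rule locally_trivial_in_conjugate)
        show "openin Y (U \<inter> ?W)"
          using U(1) W by blast
      qed (use U y g in \<open>auto simp: stabilizer_def\<close>)
    qed
    then show "y \<in> conj_stab_points G H Y \<beta>"
      using y conjugate_at[OF y] by (metis (mono_tags, lifting) conj_stab_points_def mem_Collect_eq subsetI subset_antisym)
  next
    assume "y \<in> conj_stab_points G H Y \<beta>"
    then have "conjugate_at y = stabilizer G \<beta> y"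
      by (intro conjugate_at_eqI) (auto simp: conj_stab_points_def)
    moreover have "\<beta> g z = z" if "g \<in> conjugate_at y" "z \<in> ?W" for g z
      using that conjugate_at(2)[of z] by (auto simp: stabilizer_def)
    ultimately show "trivial_holonomy G Y \<beta> y"
      unfolding trivial_holonomy_def using W y by blast
  }
qed

lemma stabilizers_conj_stab_points:
  "stabilizer G \<beta> ` conj_stab_points G H Y \<beta> = conjugates G H"
proof (intro equalityI subsetI)
  fix K assume K: "K \<in> conjugates G H"
  obtain y0 where y0: "y0 \<in> topspace Y" "stabilizer G \<beta> y0 \<in> conjugates G H"
    using conj_stab_point by (auto simp: conj_stab_points_def)
  obtain g where g: "g \<in> carrier G" "K = conj_by G g (stabilizer G \<beta> y0)"
    using conjugates_transitive[OF H_subset y0(2) K] .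
  then have "K = stabilizer G \<beta> (\<beta> g y0)" "\<beta> g y0 \<in> conj_stab_points G H Y \<beta>"
    using y0 K by (auto simp: stabilizer_act act_in conj_stab_points_def)
  then show "K \<in> stabilizer G \<beta> ` conj_stab_points G H Y \<beta>"
    by blast
qed (auto simp: conj_stab_points_def)

end

section \<open>The Chabauty topology\<close>

context group
begin

lemma openin_chabauty_basic:
  assumes "finite A" "finite B" "A \<subseteq> carrier G" "B \<subseteq> carrier G"
  shows "openin (chabauty G) {K. subgroup K G \<and> A \<subseteq> K \<and> B \<inter> K = {}}"
  unfolding chabauty_def using assms by (intro topology_generated_by_Basis) blast

lemma topspace_chabauty: "topspace (chabauty G) = {K. subgroup K G}"
proof -
  have "openin (chabauty G) {K. subgroup K G}"
    using openin_chabauty_basic[of "{}" "{}"] by simp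
  then have "{K. subgroup K G} \<subseteq> topspace (chabauty G)"
    by (rule openin_subset)
  then show ?thesis
    by (auto simp: chabauty_def)
qed

text \<open>Two distinct subgroups are told apart by an element that lies in only one of them, so the Chabauty topology is
\<open>T\<^sub>1\<close>.\<close>

lemma closedin_chabauty_finite:
  assumes "finite \<F>" "\<And>K. K \<in> \<F> \<Longrightarrow> subgroup K G"
  shows "closedin (chabauty G) \<F>"
proof -
  have "t1_space (chabauty G)"
    unfolding t1_space_def topspace_chabauty
  proof (intro ballI impI)
    fix K L assume "K \<in> {K. subgroup K G}" "L \<in> {K. subgroup K G}" "K \<noteq> L"
    then have K: "subgroup K G" and L: "subgroup L G" and "K \<noteq> L"
      by auto
    then consider g where "g \<in> K" "g \<notin> L" | g where "g \<in> L" "g \<notin> K"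
      by blast
    then show "\<exists>U. openin (chabauty G) U \<and> K \<in> U \<and> L \<notin> U"
    proof cases
      case 1
      then show ?thesis
        using K openin_chabauty_basic[of "{g}" "{}"] subgroup.subset[OF K]
        by (intro exI[of _ "{K. subgroup K G \<and> {g} \<subseteq> K \<and> {} \<inter> K = {}}"]) auto
    next
      case 2
      then show ?thesis
        using K openin_chabauty_basic[of "{}" "{g}"] subgroup.subset[OF L]
        by (intro exI[of _ "{K. subgroup K G \<and> {} \<subseteq> K \<and> {g} \<inter> K = {}}"]) auto
    qed
  qed
  then show ?thesis
    using assms by (intro t1_space_closedin_finite[THEN iffD1, rule_format]) (auto simp: topspace_chabauty)
qed

end

section \<open>Stabilizer URS and local quasi-analyticity\<close>

context conjugate_stabilizer_system
begin

lemma closedin_conjugates: "closedin (chabauty G) (conjugates G H)"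
  using finite_conjugates conjugates_subgroup[OF subgroup_H] by (rule closedin_chabauty_finite)

lemma stabilizer_URS_eq: "stabilizer_URS G Y \<beta> = conjugates G H"
proof -
  have "{y \<in> topspace Y. trivial_holonomy G Y \<beta> y} = conj_stab_points G H Y \<beta>"
    using trivial_holonomy_iff by (auto simp: conj_stab_points_def)
  then have "{stabilizer G \<beta> y | y. y \<in> topspace Y \<and> trivial_holonomy G Y \<beta> y} = conjugates G H"
    using stabilizers_conj_stab_points by blast
  then show ?thesis
    unfolding stabilizer_URS_def using closedin_conjugates by (simp add: closure_of_closedin)
qed

text \<open>The constant is a Lebesgue number of the clopen partition into the fibers of \<open>conjugate_at\<close>: a
smaller set lies in a single fiber, all of which is fixed by the corresponding conjugate of \<open>H\<close>.\<close>

lemma locally_quasi_analytic: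
  assumes "compatible_metric Y d"
  shows "locally_quasi_analytic G Y \<beta> d"
proof -
  interpret Metric_space "topspace Y" d
    using assms by (simp add: compatible_metric_def)
  have top: "mtopology = Y"
    using assms by (simp add: compatible_metric_def)
  let ?F = "\<lambda>K. {y \<in> topspace Y. conjugate_at y = K}"
  have compact_Y: "compactin mtopology (topspace Y)"
    using compact by (simp add: top compact_space_def)
  have "\<exists>\<epsilon>>0. \<forall>x\<in>topspace Y. \<exists>U\<in>?F ` conjugates G H. mball x \<epsilon> \<subseteq> U"
    using compact_Y conjugate_at(1) openin_conjugate_at by (intro lebesgue_number) (auto simp: top)
  then obtain \<epsilon> where \<epsilon>: "\<epsilon> > 0" "\<And>x. x \<in> topspace Y \<Longrightarrow> \<exists>K\<in>conjugates G H. mball x \<epsilon> \<subseteq> ?F K"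
    by (metis (no_types, lifting) imageE)
  have "\<beta> g z = z" if U: "openin Y U" "set_diameter d U < \<epsilon>" and g: "g \<in> carrier G"
    and V: "openin Y V" "V \<noteq> {}" "V \<subseteq> U" "\<forall>z\<in>V. \<beta> g z = z" and z: "z \<in> U" for U g V z
  proof -
    have sub: "U \<subseteq> topspace Y"
      using U(1) by (rule openin_subset)
    \<comment> \<open>The supremum in \<open>set_diameter\<close> bounds distances only on bounded sets.\<close>
    obtain b where b: "\<And>x y. x \<in> topspace Y \<Longrightarrow> y \<in> topspace Y \<Longrightarrow> d x y \<le> b"
      using compactin_imp_mbounded[OF compact_Y] by (auto simp: mbounded_alt)
    have "d z w < \<epsilon>" if w: "w \<in> U" for w
    proof -
      have "bdd_above ((\<lambda>(x, y). d x y) ` (U \<times> U))"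
        using b sub by (intro bdd_aboveI2[of _ _ b]) auto
      then have "d z w \<le> (SUP (x, y) \<in> U \<times> U. d x y)"
        using z w by (intro cSUP_upper2[of _ _ "(z, w)"]) auto
      then show ?thesis
        using U(2) z by (auto simp: set_diameter_def split: if_splits)
    qed
    then have "U \<subseteq> mball z \<epsilon>"
      using sub z by (auto simp: in_mball)
    moreover obtain K where "mball z \<epsilon> \<subseteq> ?F K"
      using \<epsilon>(2)[OF subsetD[OF sub z]] by blast
    ultimately have K: "U \<subseteq> ?F K"
      by (rule order_trans)
    then have "g \<in> K"
      using V K by (intro locally_trivial_in_conjugate[OF g V(1,2)]) blast+
    then show ?thesis
      using K z conjugate_at(2)[of z] by (auto simp: stabilizer_def)
  qed
  then show ?thesis
    unfolding locally_quasi_analytic_def using \<epsilon>(1) by blast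
qed

end

section \<open>Quotients of minimal systems\<close>

text \<open>A quotient of a minimal system inherits everything but the Hausdorff property. The homomorphism laws
for \<open>\<beta>\<close> are forced by equivariance because \<open>q\<close> is onto; being extensional is required of
the elements of \<open>BijGroup\<close>.\<close>

lemma minimal_system_quotient:
  assumes "minimal_system G X \<alpha>" and q: "quotient_map X Y q" and Y: "Hausdorff_space Y"
    and eq: "\<And>g x. \<lbrakk>g \<in> carrier G; x \<in> topspace X\<rbrakk> \<Longrightarrow> \<beta> g (q x) = q (\<alpha> g x)"
    and ext: "\<And>g. g \<in> carrier G \<Longrightarrow> \<beta> g \<in> extensional (topspace Y)"
  shows "minimal_system G Y \<beta>"
proof -
  interpret minimal_system G X \<alpha> by fact
  have surj: "q ` topspace X = topspace Y"
    using q by (rule quotient_imp_surjective_map)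
  have in_Y: "\<exists>x \<in> topspace X. y = q x" if "y \<in> topspace Y" for y
    using that surj by blast
  have \<beta>_in: "\<beta> g y \<in> topspace Y" if "g \<in> carrier G" "y \<in> topspace Y" for g y
    using in_Y[OF that(2)] that(1) surj act_in by (auto simp: eq)
  have \<beta>_mult: "\<beta> (g \<otimes>\<^bsub>G\<^esub> h) y = \<beta> g (\<beta> h y)"
    if "g \<in> carrier G" "h \<in> carrier G" "y \<in> topspace Y" for g h y
    using in_Y[OF that(3)] that(1,2) by (auto simp: eq act_in composition_rule)
  have \<beta>_inv: "\<beta> (inv\<^bsub>G\<^esub> g) (\<beta> g y) = y" "\<beta> g (\<beta> (inv\<^bsub>G\<^esub> g) y) = y"
    if "g \<in> carrier G" "y \<in> topspace Y" for g y
    using in_Y[OF that(2)] that(1) by (auto simp: eq act_in act_inv)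
  have cont: "continuous_map Y Y (\<beta> g)" if g: "g \<in> carrier G" for g
  proof (rule continuous_compose_quotient_map[OF q])
    have "continuous_map X Y (q \<circ> \<alpha> g)"
      using continuous_act[OF g] quotient_imp_continuous_map[OF q] by (rule continuous_map_compose)
    then show "continuous_map X Y (\<beta> g \<circ> q)"
      by (rule continuous_map_eq) (simp add: eq g)
  qed
  have "\<beta> g \<in> Bij (topspace Y)" if g: "g \<in> carrier G" for g
    using ext[OF g] g \<beta>_in \<beta>_inv inv_closed[OF g] unfolding Bij_def
    by (auto intro!: bij_betw_byWitness[where f' = "\<beta> (inv\<^bsub>G\<^esub> g)"])
  then have "\<beta> \<in> hom G (BijGroup (topspace Y))"
    using \<beta>_mult \<beta>_in ext
    by (auto simp: hom_def BijGroup_def compose_def intro!: extensionalityI[of _ "topspace Y"])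
  then have "group_action G (topspace Y) \<beta>"
    unfolding group_action_def group_hom_def group_hom_axioms_def
    by (simp add: group_BijGroup is_group)
  moreover have "homeomorphic_map Y Y (\<beta> g)" if g: "g \<in> carrier G" for g
    unfolding homeomorphic_map_maps homeomorphic_maps_def
    using cont g inv_closed[OF g] \<beta>_inv by blast
  moreover have "compact_space Y"
    using image_compactin[OF _ quotient_imp_continuous_map[OF q], of "topspace X"] compact surj
    by (simp add: compact_space_def)
  ultimately have "dynamical_system G Y \<beta>"
    using countable_group finitely_generated Y
    by (simp add: dynamical_system_def dynamical_system_axioms_def)
  moreover have "topspace Y \<noteq> {}"
    using nonempty surj by blast
  moreover have "C = topspace Y"
    if C: "closedin Y C" "C \<noteq> {}" "\<forall>g\<in>carrier G. \<beta> g ` C \<subseteq> C" for C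
  proof -
    define D where "D = {x \<in> topspace X. q x \<in> C}"
    have "closedin X D"
      unfolding D_def using quotient_imp_continuous_map[OF q] C(1)
      by (rule closedin_continuous_map_preimage)
    moreover have "D \<noteq> {}"
      using C(1,2) closedin_subset[OF C(1)] in_Y unfolding D_def by blast
    moreover have "\<alpha> g x \<in> D" if "g \<in> carrier G" "x \<in> D" for g x
      using that C(3) eq[of g x] act_in[of g x] unfolding D_def by force
    ultimately have "D = topspace X"
      using closed_invariant_eq_topspace by blast
    then show ?thesis
      using closedin_subset[OF C(1)] in_Y unfolding D_def by blast
  qed
  ultimately show ?thesis
    by (simp add: minimal_system_def minimal_system_axioms_def)
qed

definition quotient_topology :: "'x topology \<Rightarrow> ('x \<Rightarrow> 'y) \<Rightarrow> 'y topology" where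
  "quotient_topology X q =
    topology (\<lambda>V. V \<subseteq> q ` topspace X \<and> openin X {x \<in> topspace X. q x \<in> V})"

lemma openin_quotient_topology:
  "openin (quotient_topology X q) V \<longleftrightarrow>
    V \<subseteq> q ` topspace X \<and> openin X {x \<in> topspace X. q x \<in> V}"
proof -
  have "istopology (\<lambda>V. V \<subseteq> q ` topspace X \<and> openin X {x \<in> topspace X. q x \<in> V})"
    unfolding istopology_def
  proof (intro conjI allI impI)
    fix S T
    assume "S \<subseteq> q ` topspace X \<and> openin X {x \<in> topspace X. q x \<in> S}"
      and "T \<subseteq> q ` topspace X \<and> openin X {x \<in> topspace X. q x \<in> T}"
    moreover have "{x \<in> topspace X. q x \<in> S \<inter> T} =
        {x \<in> topspace X. q x \<in> S} \<inter> {x \<in> topspace X. q x \<in> T}"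
      by blast
    ultimately show "S \<inter> T \<subseteq> q ` topspace X" "openin X {x \<in> topspace X. q x \<in> S \<inter> T}"
      by auto
  next
    fix \<K>
    assume K: "\<forall>K\<in>\<K>. K \<subseteq> q ` topspace X \<and> openin X {x \<in> topspace X. q x \<in> K}"
    moreover have "{x \<in> topspace X. q x \<in> \<Union>\<K>} = (\<Union>K\<in>\<K>. {x \<in> topspace X. q x \<in> K})"
      by blast
    ultimately show "\<Union>\<K> \<subseteq> q ` topspace X" "openin X {x \<in> topspace X. q x \<in> \<Union>\<K>}"
      by auto
  qed
  then show ?thesis
    by (simp add: quotient_topology_def topology_inverse')
qed

lemma topspace_quotient_topology: "topspace (quotient_topology X q) = q ` topspace X"
proof -
  have "{x \<in> topspace X. q x \<in> q ` topspace X} = topspace X"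
    by blast
  then have "openin (quotient_topology X q) (q ` topspace X)"
    by (simp add: openin_quotient_topology)
  moreover have "topspace (quotient_topology X q) \<subseteq> q ` topspace X"
    using openin_topspace[of "quotient_topology X q"] unfolding openin_quotient_topology by blast
  ultimately show ?thesis
    using openin_subset by blast
qed

lemma quotient_map_quotient_topology: "quotient_map X (quotient_topology X q) q"
  by (simp add: quotient_map_def topspace_quotient_topology openin_quotient_topology)

section \<open>The quotient by a locally constant choice of conjugates\<close>

text \<open>A locally constant equivariant choice \<open>L\<close> of conjugates of \<open>H\<close>, as provided by a factor map onto
\<open>G / N\<^sub>G(H)\<close>. The identity \<open>L (k x) = L x\<close> for \<open>k \<in> L x\<close> makes the sets
\<open>L_orbit x = {k x | k \<in> L x}\<close> a partition, and the desired factor is the space of these sets.\<close>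

locale conjugate_field_system = minimal_system G X \<alpha>
  for G :: "('g, 'm) monoid_scheme" (structure)
    and X :: "'x topology" and \<alpha> :: "'g \<Rightarrow> 'x \<Rightarrow> 'x" +
  fixes H :: "'g set" and L :: "'x \<Rightarrow> 'g set"
  assumes subgroup_H: "subgroup H G" and finite_H: "finite H"
    and finite_conjugates: "finite (conjugates G H)"
    and free_point: "free_points G X \<alpha> \<noteq> {}"
    and factor_map_L: "factor_map G X \<alpha> (discrete_topology (conjugates G H)) (conj_by G) L"
begin

lemma L_in: "x \<in> topspace X \<Longrightarrow> L x \<in> conjugates G H"
  using factor_map_L by (auto simp: factor_map_def)

lemma L_act: "\<lbrakk>g \<in> carrier G; x \<in> topspace X\<rbrakk> \<Longrightarrow> L (\<alpha> g x) = conj_by G g (L x)"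
  using factor_map_L by (auto simp: factor_map_def)

lemma closedin_L: 
  assumes "K \<in> conjugates G H"
  shows "closedin X {x \<in> topspace X. L x = K}"
proof -
  have "closedin X {x \<in> topspace X. L x \<in> {K}}"
    using factor_map_L assms
    by (intro closedin_continuous_map_preimage[of _ "discrete_topology (conjugates G H)"])
       (auto simp: factor_map_def)
  then show ?thesis by simp
qed

lemma subgroup_conjugate: "K \<in> conjugates G H \<Longrightarrow> subgroup K G"
  using conjugates_subgroup[OF subgroup_H] .

lemma L_carrier: "\<lbrakk>x \<in> topspace X; k \<in> L x\<rbrakk> \<Longrightarrow> k \<in> carrier G"
  using subgroup_conjugate[OF L_in] subgroup.mem_carrier by metis

text \<open>The singletons of the non-trivial elements of conjugates of \<open>H\<close> form a finite invariant family. If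
one of these elements had a fixed point, then every stabilizer would contain one of them, but there is a free
point. It is this lemma that makes all fibers of the quotient map have size \<open>card H\<close>, and not just those over
free points.\<close>

lemma conjugate_element_acts_freely:
  assumes K: "K \<in> conjugates G H" "k \<in> K" "k \<noteq> \<one>" and x: "x \<in> topspace X"
  shows "\<alpha> k x \<noteq> x"
proof
  assume fixed: "\<alpha> k x = x"
  define \<K> where "\<K> = (\<lambda>k. {k}) ` (\<Union>(conjugates G H) - {\<one>})"
  have H: "H \<subseteq> carrier G"
    using subgroup_H by (rule subgroup.subset)
  have sub: "k \<in> carrier G" if "K \<in> conjugates G H" "k \<in> K" for k K
    using subgroup_conjugate[OF that(1)] that(2) by (rule subgroup.mem_carrier)
  have fin: "finite \<K>"
    using finite_conjugates conjugates_finite[OF finite_H] unfolding \<K>_def by blast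
  have carrier: "C \<subseteq> carrier G" if "C \<in> \<K>" for C
    using that sub by (auto simp: \<K>_def)
  have inv: "conj_by G g C \<in> \<K>" if g: "g \<in> carrier G" and C: "C \<in> \<K>" for g C
  proof -
    obtain K k where k: "K \<in> conjugates G H" "k \<in> K" "k \<noteq> \<one>" "C = {k}"
      using C by (auto simp: \<K>_def)
    have "g \<otimes> k \<otimes> inv g \<in> conj_by G g K"
      using k(2) by (auto simp: conj_by_def)
    moreover have "conj_by G g K \<in> conjugates G H"
      using conj_by_in_conjugates[OF H g k(1)] .
    moreover have "g \<otimes> k \<otimes> inv g \<noteq> \<one>"
    proof
      assume "g \<otimes> k \<otimes> inv g = \<one>"
      also have "\<one> = g \<otimes> \<one> \<otimes> inv g"
        using g by simp
      finally show False
        using conjugation_is_inj[OF g sub[OF k(1,2)] one_closed] k(3) by blast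
    qed
    ultimately show ?thesis
      using k(4) by (auto simp: \<K>_def conj_by_def)
  qed
  have "{k} \<in> \<K>" "{k} \<subseteq> stabilizer G \<alpha> x"
    using K fixed sub by (auto simp: \<K>_def stabilizer_def)
  moreover obtain x0 where x0: "x0 \<in> topspace X" "stabilizer G \<alpha> x0 = {\<one>}"
    using free_point by (auto simp: free_points_def)
  ultimately obtain C where "C \<in> \<K>" "C \<subseteq> stabilizer G \<alpha> x0"
    using fixed_by_finite_invariant_family[OF fin carrier inv x] by blast
  then show False
    using x0(2) by (auto simp: \<K>_def)
qed

definition L_orbit :: "'x \<Rightarrow> 'x set" where
  "L_orbit x = (\<lambda>k. \<alpha> k x) ` L x"

lemma L_orbit_self: "x \<in> topspace X \<Longrightarrow> x \<in> L_orbit x"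
  unfolding L_orbit_def using subgroup.one_closed[OF subgroup_conjugate[OF L_in]] act_one
  by (metis image_eqI)

lemma L_orbit_subset: "x \<in> topspace X \<Longrightarrow> L_orbit x \<subseteq> topspace X"
  using L_carrier act_in by (auto simp: L_orbit_def)

text \<open>By equivariance \<open>L (k x)\<close> is the conjugate of the group \<open>L x\<close> by its own element \<open>k\<close>.\<close>

lemma L_on_orbit:
  assumes x: "x \<in> topspace X" and k: "k \<in> L x"
  shows "L (\<alpha> k x) = L x"
proof -
  interpret K: subgroup "L x" G
    using subgroup_conjugate[OF L_in[OF x]] .
  have "conj_by G k (L x) \<subseteq> L x" "conj_by G (inv k) (L x) \<subseteq> L x"
    using k by (auto simp: conj_by_def)
  moreover from this(2) have "conj_by G k (conj_by G (inv k) (L x)) \<subseteq> conj_by G k (L x)"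
    unfolding conj_by_def by blast
  ultimately show ?thesis
    using L_act[OF _ x] k by (simp add: conj_by_inv_cancel K.subset subset_antisym)
qed

lemma L_orbit_eq:
  assumes x: "x \<in> topspace X" and k: "k \<in> L x"
  shows "L_orbit (\<alpha> k x) = L_orbit x"
proof -
  interpret K: subgroup "L x" G
    using subgroup_conjugate[OF L_in[OF x]] .
  have "\<alpha> h (\<alpha> k x) = \<alpha> (h \<otimes> k) x" if "h \<in> L x" for h
    using that k x by (simp add: composition_rule)
  then have "L_orbit (\<alpha> k x) = (\<lambda>h. \<alpha> (h \<otimes> k) x) ` L x"
    unfolding L_orbit_def L_on_orbit[OF x k] by (rule image_cong[OF refl])
  also have "\<dots> = (\<lambda>h. \<alpha> h x) ` ((\<lambda>h. h \<otimes> k) ` L x)"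
    by (simp add: image_image)
  also have "(\<lambda>h. h \<otimes> k) ` L x = L x"
  proof (intro equalityI subsetI)
    fix h assume "h \<in> L x"
    then have "h = (h \<otimes> inv k) \<otimes> k" "h \<otimes> inv k \<in> L x"
      using k by (simp_all add: m_assoc)
    then show "h \<in> (\<lambda>h. h \<otimes> k) ` L x"
      by blast
  qed (use k in auto)
  finally show ?thesis
    by (simp add: L_orbit_def)
qed

lemma L_orbit_eq_iff:
  assumes "x \<in> topspace X" "z \<in> topspace X"
  shows "L_orbit z = L_orbit x \<longleftrightarrow> z \<in> L_orbit x"
  using L_orbit_self[OF assms(2)] L_orbit_eq[OF assms(1)] by (auto simp: L_orbit_def)

lemma act_L_orbit:
  assumes g: "g \<in> carrier G" and x: "x \<in> topspace X"
  shows "\<alpha> g ` L_orbit x = L_orbit (\<alpha> g x)"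
proof -
  have "\<alpha> g (\<alpha> k x) = \<alpha> (g \<otimes> k \<otimes> inv g) (\<alpha> g x)" if "k \<in> L x" for k
    using g x L_carrier[OF x that] by (simp add: composition_rule act_in act_inv)
  then show ?thesis
    unfolding L_orbit_def L_act[OF g x] conj_by_def image_image by (rule image_cong[OF refl])
qed

lemma card_L_orbit:
  assumes x: "x \<in> topspace X"
  shows "finite (L_orbit x)" "card (L_orbit x) = card H"
proof -
  interpret K: subgroup "L x" G
    using subgroup_conjugate[OF L_in[OF x]] .
  have "inj_on (\<lambda>k. \<alpha> k x) (L x)"
  proof (rule inj_onI)
    fix h k assume hk: "h \<in> L x" "k \<in> L x" "\<alpha> h x = \<alpha> k x"
    then have "\<alpha> (inv k \<otimes> h) x = x"
      using x by (simp add: composition_rule act_inv)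
    moreover have "inv k \<otimes> h \<in> L x"
      using hk by simp
    ultimately have "inv k \<otimes> h = \<one>"
      using conjugate_element_acts_freely[OF L_in[OF x]] x by blast
    then show "h = k"
      using hk by (metis K.mem_carrier inv_equality inv_inv m_closed inv_closed)
  qed
  then show "card (L_orbit x) = card H"
    using conjugates_card[OF subgroup.subset[OF subgroup_H] L_in[OF x]]
    by (simp add: L_orbit_def card_image)
  show "finite (L_orbit x)"
    using conjugates_finite[OF finite_H L_in[OF x]] by (simp add: L_orbit_def)
qed

definition orbit_space :: "'x set topology" where
  "orbit_space = quotient_topology X L_orbit"

definition orbit_action :: "'g \<Rightarrow> 'x set \<Rightarrow> 'x set" where
  "orbit_action g = (\<lambda>C \<in> topspace orbit_space. \<alpha> g ` C)"

lemma topspace_orbit_space: "topspace orbit_space = L_orbit ` topspace X"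
  by (simp add: orbit_space_def topspace_quotient_topology)

lemma quotient_map_L_orbit: "quotient_map X orbit_space L_orbit"
  unfolding orbit_space_def by (rule quotient_map_quotient_topology)

lemma fiber_L_orbit: "x \<in> topspace X \<Longrightarrow> {z \<in> topspace X. L_orbit z = L_orbit x} = L_orbit x"
  using L_orbit_eq_iff L_orbit_subset by blast

text \<open>The saturation of a closed set is a finite union of translates \<open>k C'\<close>, where \<open>C'\<close> is the
part of the closed set on which \<open>L\<close> has a fixed value and \<open>k\<close> belongs to that value. The quotient is Hausdorff
because closed continuous images of compact Hausdorff spaces are.\<close>

lemma closed_map_L_orbit: "closed_map X orbit_space L_orbit"
  unfolding closed_map_def
proof (intro allI impI)
  fix C assume C: "closedin X C"
  let ?C = "\<lambda>K. C \<inter> {x \<in> topspace X. L x = K}"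
  have sub: "C \<subseteq> topspace X"
    using C by (rule closedin_subset)
  have "{z \<in> topspace X. L_orbit z \<in> L_orbit ` C} = (\<Union>x\<in>C. L_orbit x)"
    using L_orbit_eq_iff L_orbit_subset sub by blast
  also have "\<dots> = (\<Union>K\<in>conjugates G H. \<Union>k\<in>K. \<alpha> k ` ?C K)"
    using sub L_in by (auto simp: L_orbit_def)
  finally have eq: "{z \<in> topspace X. L_orbit z \<in> L_orbit ` C} =
      (\<Union>K\<in>conjugates G H. \<Union>k\<in>K. \<alpha> k ` ?C K)" .
  have "closedin X (\<alpha> k ` ?C K)" if "K \<in> conjugates G H" "k \<in> K" for K k
  proof -
    have "closed_map X X (\<alpha> k)"
      using homeo[OF subgroup.mem_carrier[OF subgroup_conjugate[OF that(1)] that(2)]]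
      by (rule homeomorphic_imp_closed_map)
    then show ?thesis
      using C closedin_L[OF that(1)] by (simp add: closed_map_def closedin_Int)
  qed
  then have "closedin X {z \<in> topspace X. L_orbit z \<in> L_orbit ` C}"
    unfolding eq using finite_conjugates conjugates_finite[OF finite_H]
    by (auto intro!: closedin_Union)
  moreover have "L_orbit ` C \<subseteq> topspace orbit_space"
    using sub by (auto simp: topspace_orbit_space)
  ultimately show "closedin orbit_space (L_orbit ` C)"
    using quotient_map_L_orbit[unfolded quotient_map_closedin] by blast
qed

lemma minimal_orbit_space: "minimal_system G orbit_space orbit_action"
proof (rule minimal_system_quotient[OF minimal_system_axioms quotient_map_L_orbit])
  show "Hausdorff_space orbit_space"
    using normal_Hausdorff_space_closed_continuous_map_image[OF _ Hausdorff closed_map_L_orbit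
        quotient_imp_continuous_map[OF quotient_map_L_orbit]
        quotient_imp_surjective_map[OF quotient_map_L_orbit]]
      compact_Hausdorff_or_regular_imp_normal_space compact Hausdorff by blast
qed (auto simp: orbit_action_def topspace_orbit_space act_L_orbit)

lemma factor_map_L_orbit: "factor_map G X \<alpha> orbit_space orbit_action L_orbit"
  using quotient_imp_continuous_map[OF quotient_map_L_orbit]
  by (auto simp: factor_map_def orbit_action_def topspace_orbit_space act_L_orbit)

lemma orbit_stabilizer_eq:
  assumes x: "x \<in> topspace X"
  shows "stabilizer G orbit_action (L_orbit x) = {g \<in> carrier G. \<alpha> g x \<in> L_orbit x}"
proof -
  have "orbit_action g (L_orbit x) = L_orbit x \<longleftrightarrow> \<alpha> g x \<in> L_orbit x" if "g \<in> carrier G" for g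
    using that x L_orbit_eq_iff[OF x act_in[OF that x]]
    by (simp add: orbit_action_def topspace_orbit_space act_L_orbit)
  then show ?thesis
    by (auto simp: stabilizer_def)
qed

text \<open>The stabilizer of \<open>L_orbit x\<close> is \<open>L x\<close> times the stabilizer of \<open>x\<close>. If the latter is
trivial this is the conjugate \<open>L x\<close>. If the product is a conjugate of \<open>H\<close>, it equals \<open>L x\<close> by counting, so
the stabilizer of \<open>x\<close> lies in \<open>L x\<close>, where only \<open>\<one>\<close> has fixed points.\<close>

lemma conj_stab_points_L_orbit:
  assumes x: "x \<in> topspace X"
  shows "L_orbit x \<in> conj_stab_points G H orbit_space orbit_action \<longleftrightarrow> stabilizer G \<alpha> x = {\<one>}"
proof -
  interpret K: subgroup "L x" G
    using subgroup_conjugate[OF L_in[OF x]] .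
  let ?S = "stabilizer G orbit_action (L_orbit x)"
  have L_sub: "L x \<subseteq> ?S"
  proof
    fix k assume "k \<in> L x"
    then show "k \<in> ?S"
      unfolding orbit_stabilizer_eq[OF x] by (simp add: L_orbit_def)
  qed
  have stab_sub: "stabilizer G \<alpha> x \<subseteq> ?S"
  proof
    fix g assume "g \<in> stabilizer G \<alpha> x"
    then have "g \<in> carrier G" "\<alpha> g x = x"
      by (simp_all add: stabilizer_def)
    then show "g \<in> ?S"
      unfolding orbit_stabilizer_eq[OF x] using L_orbit_self[OF x] by simp
  qed
  have one: "\<one> \<in> stabilizer G \<alpha> x"
    using act_one[OF x] by (simp add: stabilizer_def)
  have "?S \<in> conjugates G H \<longleftrightarrow> stabilizer G \<alpha> x = {\<one>}"
  proof
    assume S: "?S \<in> conjugates G H"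
    have "L x = ?S"
      using S L_sub L_in[OF x] by (intro conjugates_eqI[OF subgroup.subset[OF subgroup_H] finite_H])
    have "g = \<one>" if g: "g \<in> stabilizer G \<alpha> x" for g
    proof -
      have "g \<in> L x"
        using g stab_sub \<open>L x = ?S\<close> by blast
      moreover have "\<alpha> g x = x"
        using g by (simp add: stabilizer_def)
      ultimately show ?thesis
        using conjugate_element_acts_freely[OF L_in[OF x] _ _ x] by blast
    qed
    then show "stabilizer G \<alpha> x = {\<one>}"
      using one by blast
  next
    assume free: "stabilizer G \<alpha> x = {\<one>}"
    have "g \<in> L x" if g: "g \<in> ?S" for g
    proof -
      obtain k where k: "k \<in> L x" "g \<in> carrier G" "\<alpha> g x = \<alpha> k x"
        using g unfolding orbit_stabilizer_eq[OF x] by (auto simp: L_orbit_def elim!: imageE)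
      then have "inv k \<otimes> g \<in> stabilizer G \<alpha> x"
        using x by (simp add: stabilizer_def composition_rule act_inv)
      then have "inv k \<otimes> g = \<one>"
        using free by blast
      then have "g = k"
        using k by (metis K.mem_carrier inv_equality inv_inv inv_closed)
      then show ?thesis
        using k(1) by simp
    qed
    then have "?S = L x"
      using L_sub by blast
    then show "?S \<in> conjugates G H"
      using L_in[OF x] by simp
  qed
  then show ?thesis
    using x by (auto simp: conj_stab_points_def topspace_orbit_space)
qed

lemma conj_stab_factor_L_orbit: "conj_stab_factor G X \<alpha> H orbit_space orbit_action L_orbit"
  unfolding conj_stab_factor_def
proof (intro conjI ballI)
  fix y assume "y \<in> topspace orbit_space"
  then show "fiber_has_size X L_orbit (card H) y"
    using card_L_orbit fiber_L_orbit by (auto simp: fiber_has_size_def topspace_orbit_space)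
qed (use minimal_orbit_space factor_map_L_orbit conj_stab_points_L_orbit in
  \<open>auto simp: free_points_def\<close>)

end

section \<open>Borel measures and stabilizers\<close>

lemma space_borel_of: "space (borel_of X) = topspace X"
  unfolding borel_of_def by (intro space_measure_of) (auto dest: openin_subset)

lemma sets_borel_of: "sets (borel_of X) = sigma_sets (topspace X) {U. openin X U}"
  unfolding borel_of_def by (intro sets_measure_of) (auto dest: openin_subset)

lemma openin_in_borel_of: "openin X U \<Longrightarrow> U \<in> sets (borel_of X)"
  by (simp add: sets_borel_of)

lemma closedin_in_borel_of:
  assumes "closedin X C"
  shows "C \<in> sets (borel_of X)"
proof -
  have "topspace X - (topspace X - C) \<in> sets (borel_of X)"
    using assms openin_in_borel_of[of X "topspace X - C"]
    by (metis closedin_def sets.compl_sets space_borel_of)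
  then show ?thesis
    using closedin_subset[OF assms] by (simp add: double_diff)
qed

lemma measurable_borel_of:
  assumes "\<And>x. x \<in> space M \<Longrightarrow> f x \<in> topspace Y"
    and "\<And>U. openin Y U \<Longrightarrow> f -` U \<inter> space M \<in> sets M"
  shows "f \<in> measurable M (borel_of Y)"
  unfolding borel_of_def using assms
  by (intro measurable_measure_of) (auto dest: openin_subset)

lemma continuous_map_measurable:
  assumes "continuous_map X Y f"
  shows "f \<in> measurable (borel_of X) (borel_of Y)"
proof (rule measurable_borel_of)
  fix U assume "openin Y U"
  then have "openin X {x \<in> topspace X. f x \<in> U}"
    using assms openin_continuous_map_preimage by blast
  then show "f -` U \<inter> space (borel_of X) \<in> sets (borel_of X)"
    using openin_in_borel_of by (simp add: space_borel_of vimage_def Int_def conj_commute)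
qed (use assms in \<open>auto simp: space_borel_of continuous_map_def\<close>)

text \<open>The sets used to generate the Chabauty topology are closed under finite intersections, hence a basis. For
countable \<open>G\<close> this basis is countable, which is what reduces Borel measurability to its members.\<close>

lemma openin_chabauty_basis:
  assumes "openin (chabauty G) U" "K \<in> U"
  shows "\<exists>A B. finite A \<and> finite B \<and> A \<subseteq> carrier G \<and> B \<subseteq> carrier G \<and>
    K \<in> {K. subgroup K G \<and> A \<subseteq> K \<and> B \<inter> K = {}} \<and> {K. subgroup K G \<and> A \<subseteq> K \<and> B \<inter> K = {}} \<subseteq> U"
proof -
  let ?S = "{{K. subgroup K G \<and> A \<subseteq> K \<and> B \<inter> K = {}} | A B.
        finite A \<and> finite B \<and> A \<subseteq> carrier G \<and> B \<subseteq> carrier G}"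
  have "generate_topology_on ?S U"
    using assms(1) unfolding chabauty_def by (rule openin_topology_generated_by)
  then show ?thesis
    using assms(2)
  proof (induction arbitrary: K)
    case (Int U V)
    obtain A B where "finite A" "finite B" "A \<subseteq> carrier G" "B \<subseteq> carrier G"
      "K \<in> {K. subgroup K G \<and> A \<subseteq> K \<and> B \<inter> K = {}}"
      "{K. subgroup K G \<and> A \<subseteq> K \<and> B \<inter> K = {}} \<subseteq> U"
      using Int.IH(1)[of K] Int.prems by blast
    moreover obtain A' B' where "finite A'" "finite B'" "A' \<subseteq> carrier G" "B' \<subseteq> carrier G"
      "K \<in> {K. subgroup K G \<and> A' \<subseteq> K \<and> B' \<inter> K = {}}"
      "{K. subgroup K G \<and> A' \<subseteq> K \<and> B' \<inter> K = {}} \<subseteq> V"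
      using Int.IH(2)[of K] Int.prems by blast
    ultimately show ?case
      by (intro exI[of _ "A \<union> A'"] exI[of _ "B \<union> B'"]) auto
  next
    case (UN \<V>)
    then obtain V where V: "V \<in> \<V>" "K \<in> V"
      by blast
    have "V \<subseteq> \<Union>\<V>"
      using V by blast
    with UN.IH[OF V] show ?case
      by (meson order_trans)
  next
    case (Basis V)
    then show ?case
      by blast
  qed auto
qed

context dynamical_system
begin

lemma fixed_by_in_borel: "K \<subseteq> carrier G \<Longrightarrow> {x \<in> topspace X. K \<subseteq> stabilizer G \<alpha> x} \<in> sets (borel_of X)"
  using closedin_fixed_by closedin_in_borel_of by blast

lemma stabilizer_disjoint_in_borel:
  assumes "B \<subseteq> carrier G"
  shows "{x \<in> topspace X. B \<inter> stabilizer G \<alpha> x = {}} \<in> sets (borel_of X)"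
proof -
  have "{x \<in> topspace X. B \<inter> stabilizer G \<alpha> x = {}} =
      topspace X - (\<Union>b\<in>B. {x \<in> topspace X. {b} \<subseteq> stabilizer G \<alpha> x})"
    by auto
  moreover have "countable B"
    using assms countable_group countable_subset by blast
  moreover have "{x \<in> topspace X. {b} \<subseteq> stabilizer G \<alpha> x} \<in> sets (borel_of X)" if "b \<in> B" for b
    using assms that by (intro fixed_by_in_borel) auto
  ultimately show ?thesis
    using openin_in_borel_of[OF openin_topspace] by (auto intro!: sets.Diff sets.countable_UN')
qed

lemma stabilizer_measurable: "stabilizer G \<alpha> \<in> measurable (borel_of X) (borel_of (chabauty G))"
proof (rule measurable_borel_of)
  fix U assume U: "openin (chabauty G) U"
  define fin where "fin = {A. A \<subseteq> carrier G \<and> finite A}"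
  define I where "I = {(A, B). (A, B) \<in> fin \<times> fin \<and> {K. subgroup K G \<and> A \<subseteq> K \<and> B \<inter> K = {}} \<subseteq> U}"
  let ?P = "\<lambda>(A, B). {x \<in> topspace X. A \<subseteq> stabilizer G \<alpha> x} \<inter> {x \<in> topspace X. B \<inter> stabilizer G \<alpha> x = {}}"
  have "countable fin"
    using countable_Collect_finite_subset[OF countable_group] by (simp add: fin_def conj_commute)
  then have "countable (fin \<times> fin)"
    by blast
  then have "countable I"
    by (rule countable_subset[rotated]) (auto simp: I_def)
  moreover have "?P p \<in> sets (borel_of X)" if "p \<in> I" for p
    using that fixed_by_in_borel stabilizer_disjoint_in_borel by (auto simp: I_def fin_def)
  ultimately have "(\<Union>p\<in>I. ?P p) \<in> sets (borel_of X)"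
    by (intro sets.countable_UN') auto
  also have "(\<Union>p\<in>I. ?P p) = stabilizer G \<alpha> -` U \<inter> space (borel_of X)"
  proof (intro equalityI subsetI)
    fix x assume "x \<in> (\<Union>p\<in>I. ?P p)"
    then obtain A B where AB: "{K. subgroup K G \<and> A \<subseteq> K \<and> B \<inter> K = {}} \<subseteq> U" "x \<in> topspace X"
      "A \<subseteq> stabilizer G \<alpha> x" "B \<inter> stabilizer G \<alpha> x = {}"
      by (auto simp: I_def)
    then have "stabilizer G \<alpha> x \<in> U"
      using stabilizer_subgroup[OF AB(2)] by blast
    then show "x \<in> stabilizer G \<alpha> -` U \<inter> space (borel_of X)"
      using AB(2) by (simp add: space_borel_of)
  next
    fix x assume "x \<in> stabilizer G \<alpha> -` U \<inter> space (borel_of X)"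
    then have x: "x \<in> topspace X" "stabilizer G \<alpha> x \<in> U"
      by (auto simp: space_borel_of)
    obtain A B where "finite A" "finite B" "A \<subseteq> carrier G" "B \<subseteq> carrier G"
      "A \<subseteq> stabilizer G \<alpha> x" "B \<inter> stabilizer G \<alpha> x = {}"
      "{K. subgroup K G \<and> A \<subseteq> K \<and> B \<inter> K = {}} \<subseteq> U"
      using openin_chabauty_basis[OF U x(2)] by auto
    then have "(A, B) \<in> I" "x \<in> ?P (A, B)"
      using x(1) by (auto simp: I_def fin_def)
    then show "x \<in> (\<Union>p\<in>I. ?P p)"
      by blast
  qed
  finally show "stabilizer G \<alpha> -` U \<inter> space (borel_of X) \<in> sets (borel_of X)" .
qed (use stabilizer_subgroup in \<open>auto simp: space_borel_of topspace_chabauty\<close>)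

lemma stabilizer_fiber_in_borel:
  assumes "K \<subseteq> carrier G"
  shows "{x \<in> topspace X. stabilizer G \<alpha> x = K} \<in> sets (borel_of X)"
proof -
  have "{x \<in> topspace X. stabilizer G \<alpha> x = K} = {x \<in> topspace X. K \<subseteq> stabilizer G \<alpha> x} \<inter>
      {x \<in> topspace X. (carrier G - K) \<inter> stabilizer G \<alpha> x = {}}"
    using stabilizer_carrier by blast
  then show ?thesis
    using fixed_by_in_borel[OF assms] stabilizer_disjoint_in_borel[of "carrier G - K"] by auto
qed

lemma conj_stab_points_eq_UN:
  "conj_stab_points G H X \<alpha> = (\<Union>K\<in>conjugates G H. {x \<in> topspace X. stabilizer G \<alpha> x = K})"
  by (auto simp: conj_stab_points_def)

lemma countable_conjugates: "countable (conjugates G H)"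
  unfolding conjugates_eq using countable_group by blast

lemma conj_stab_points_in_borel:
  assumes "subgroup H G"
  shows "conj_stab_points G H X \<alpha> \<in> sets (borel_of X)"
  unfolding conj_stab_points_eq_UN
  using countable_conjugates stabilizer_fiber_in_borel[OF subgroup.subset[OF conjugates_subgroup[OF assms]]]
  by (intro sets.countable_UN') auto

text \<open>The sets of points with stabilizer \<open>K\<close>, for \<open>K\<close> a conjugate of \<open>H\<close>, are disjoint and permuted transitively by
\<open>G\<close>, so they have the same measure. It is positive, for countably many null sets cannot add up to
measure \<open>1\<close>; and a finite measure leaves room for finitely many such sets only.\<close>

lemma finite_conjugates_of_invariant_measure:
  assumes H: "subgroup H G" and inv: "invariant_measure G X \<alpha> \<mu>"
    and one: "measure \<mu> (conj_stab_points G H X \<alpha>) = 1"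
  shows "finite (conjugates G H)"
proof (rule ccontr)
  assume inf: "infinite (conjugates G H)"
  interpret prob_space \<mu>
    using inv by (simp add: invariant_measure_def)
  have sets: "sets \<mu> = sets (borel_of X)"
    using inv by (simp add: invariant_measure_def)
  have space: "space \<mu> = topspace X"
    using sets_eq_imp_space_eq[OF sets] by (simp add: space_borel_of)
  have H_sub: "H \<subseteq> carrier G"
    using H by (rule subgroup.subset)
  have sub: "K \<subseteq> carrier G" if "K \<in> conjugates G H" for K
    using conjugates_subgroup[OF H that] by (rule subgroup.subset)
  define A where "A K = {x \<in> topspace X. stabilizer G \<alpha> x = K}" for K
  have A_sets: "A K \<in> sets \<mu>" if "K \<in> conjugates G H" for K
    unfolding A_def sets using stabilizer_fiber_in_borel[OF sub[OF that]] .
  have A_measure: "prob (A K) = prob (A H)" if K: "K \<in> conjugates G H" for K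
  proof -
    obtain g where g: "g \<in> carrier G" "K = conj_by G g H"
      using K by (auto simp: conjugates_eq)
    have meas: "\<alpha> g \<in> measurable \<mu> \<mu>"
      using continuous_map_measurable[OF continuous_act[OF g(1)]]
      by (simp add: measurable_cong_sets[OF sets sets])
    have "stabilizer G \<alpha> (\<alpha> g x) = K \<longleftrightarrow> stabilizer G \<alpha> x = H" if "x \<in> topspace X" for x
      using conj_by_inv_cancel(1)[OF g(1)] H_sub stabilizer_carrier[of x]
      unfolding stabilizer_act[OF g(1) that] g(2) by metis
    then have "\<alpha> g -` A K \<inter> space \<mu> = A H"
      using act_in[OF g(1)] by (auto simp: A_def space)
    moreover have "prob (A K) = measure (distr \<mu> \<mu> (\<alpha> g)) (A K)"
      using inv g(1) by (simp add: invariant_measure_def)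
    ultimately show ?thesis
      using measure_distr[OF meas A_sets[OF K]] by simp
  qed
  have "prob (A H) > 0"
  proof (rule ccontr)
    assume "\<not> prob (A H) > 0"
    then have "A K \<in> null_sets \<mu>" if "K \<in> conjugates G H" for K
      using A_measure[OF that] A_sets[OF that] by (simp add: emeasure_eq_measure null_sets_def zero_less_measure_iff not_less measure_le_0_iff)
    then have "(\<Union>K\<in>conjugates G H. A K) \<in> null_sets \<mu>"
      using countable_conjugates by (intro null_sets_UN') auto
    then show False
      using one unfolding conj_stab_points_eq_UN A_def[symmetric] by (simp add: measure_eq_0_null_sets)
  qed
  then obtain n :: nat where n: "1 < real n * prob (A H)"
    using reals_Archimedean3 by blast
  obtain F where F: "finite F" "card F = n" "F \<subseteq> conjugates G H"
    using infinite_arbitrarily_large[OF inf] by blast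
  have "prob (\<Union>K\<in>F. A K) = (\<Sum>K\<in>F. prob (A K))"
    using F A_sets by (intro finite_measure_finite_Union) (auto simp: disjoint_family_on_def A_def)
  also have "\<dots> = (\<Sum>K\<in>F. prob (A H))"
    using F(3) A_measure by (intro sum.cong) auto
  also have "\<dots> = real n * prob (A H)"
    by (simp add: F(2))
  finally show False
    using n prob_le_1[of "\<Union>K\<in>F. A K"] by simp
qed

lemma free_point_of_essentially_free:
  assumes "prob_space \<mu>" "space \<mu> = topspace X" "essentially_free G \<alpha> \<mu>"
  shows "free_points G X \<alpha> \<noteq> {}"
proof
  interpret prob_space \<mu> by fact
  assume "free_points G X \<alpha> = {}"
  then have "AE x in \<mu>. stabilizer G \<alpha> x = {\<one>} \<longrightarrow> False"
    using assms(2) by (intro AE_I2) (auto simp: free_points_def)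
  with assms(3)[unfolded essentially_free_def] have "AE x in \<mu>. False"
    by (rule AE_mp)
  then show False
    by simp
qed

text \<open>The preimage of \<open>Y\<^sub>H\<close> is the set of free points, which has full measure.\<close>

lemma conj_stab_factor_imp_ae:
  assumes H: "subgroup H G" and \<mu>: "prob_space \<mu>" "sets \<mu> = sets (borel_of X)"
    and free: "essentially_free G \<alpha> \<mu>" and Y: "conj_stab_factor G X \<alpha> H Y \<beta> \<pi>"
  shows "ae_conj_stab_factor G X \<alpha> \<mu> H Y \<beta> \<pi>"
proof -
  interpret prob_space \<mu> by fact
  have Y: "minimal_system G Y \<beta>" and \<pi>: "factor_map G X \<alpha> Y \<beta> \<pi>"
    and fib: "\<And>y. y \<in> topspace Y \<Longrightarrow> fiber_has_size X \<pi> (card H) y"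
    and pre: "{x \<in> topspace X. \<pi> x \<in> conj_stab_points G H Y \<beta>} = free_points G X \<alpha>"
    using Y by (auto simp: conj_stab_factor_def)
  interpret Y: minimal_system G Y \<beta> by fact
  have space: "space \<mu> = topspace X"
    using sets_eq_imp_space_eq[OF \<mu>(2)] by (simp add: space_borel_of)
  have meas: "\<pi> \<in> measurable \<mu> (borel_of Y)"
    using continuous_map_measurable[of X Y \<pi>] \<pi>
    by (simp add: factor_map_def measurable_cong_sets[OF \<mu>(2) refl])
  have "AE y in distr \<mu> (borel_of Y) \<pi>. fiber_has_size X \<pi> (card H) y"
    by (rule AE_I2) (simp add: fib space_borel_of)
  moreover have "free_points G X \<alpha> \<in> sets \<mu>"
    using stabilizer_fiber_in_borel[of "{\<one>}"] by (simp add: \<mu>(2) free_points_def)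
  then have "prob (free_points G X \<alpha>) = 1"
    using free AE_space[of \<mu>]
    by (subst prob_eq_1) (auto simp: essentially_free_def free_points_def space elim: eventually_elim2)
  then have "measure (distr \<mu> (borel_of Y) \<pi>) (conj_stab_points G H Y \<beta>) = 1"
    using measure_distr[OF meas Y.conj_stab_points_in_borel[OF H]] pre
    by (simp add: space vimage_def Int_def conj_commute)
  ultimately show ?thesis
    using Y \<pi> by (simp add: ae_conj_stab_factor_def)
qed

end

lemma invariant_measure_factor:
  assumes X: "dynamical_system G X \<alpha>" and Y: "dynamical_system G Y \<beta>"
    and \<pi>: "factor_map G X \<alpha> Y \<beta> \<pi>" and inv: "invariant_measure G X \<alpha> \<mu>"
  shows "invariant_measure G Y \<beta> (distr \<mu> (borel_of Y) \<pi>)"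
proof -
  have sets: "sets \<mu> = sets (borel_of X)" and prob: "prob_space \<mu>"
    and inv: "\<And>g. g \<in> carrier G \<Longrightarrow> distr \<mu> \<mu> (\<alpha> g) = \<mu>"
    using inv by (auto simp: invariant_measure_def)
  have space: "space \<mu> = topspace X"
    using sets_eq_imp_space_eq[OF sets] by (simp add: space_borel_of)
  let ?\<nu> = "distr \<mu> (borel_of Y) \<pi>"
  have meas: "\<pi> \<in> measurable \<mu> (borel_of Y)"
    using continuous_map_measurable[of X Y \<pi>] \<pi>
    by (simp add: factor_map_def measurable_cong_sets[OF sets refl])
  have "distr ?\<nu> ?\<nu> (\<beta> g) = ?\<nu>" if g: "g \<in> carrier G" for g
  proof -
    have \<alpha>: "\<alpha> g \<in> measurable \<mu> \<mu>"
      using continuous_map_measurable[OF dynamical_system.continuous_act[OF X g]]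
      by (simp add: measurable_cong_sets[OF sets sets])
    have \<beta>: "\<beta> g \<in> measurable (borel_of Y) (borel_of Y)"
      using continuous_map_measurable[OF dynamical_system.continuous_act[OF Y g]] .
    have "distr ?\<nu> ?\<nu> (\<beta> g) = distr ?\<nu> (borel_of Y) (\<beta> g)"
      by (rule distr_cong) auto
    also have "\<dots> = distr \<mu> (borel_of Y) (\<beta> g \<circ> \<pi>)"
      by (rule distr_distr[OF \<beta> meas])
    also have "\<dots> = distr \<mu> (borel_of Y) (\<pi> \<circ> \<alpha> g)"
      using \<pi> g by (intro distr_cong) (auto simp: factor_map_def space)
    also have "\<dots> = distr (distr \<mu> \<mu> (\<alpha> g)) (borel_of Y) \<pi>"
      by (rule distr_distr[OF meas \<alpha>, symmetric])
    also have "\<dots> = ?\<nu>"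
      by (simp add: inv[OF g])
    finally show ?thesis .
  qed
  then show ?thesis
    using prob_space.prob_space_distr[OF prob meas] by (simp add: invariant_measure_def)
qed

context conjugate_stabilizer_system
begin

lemma ae_trivial_holonomy:
  assumes "prob_space \<nu>" "measure \<nu> (conj_stab_points G H Y \<beta>) = 1"
  shows "no_essential_holonomy G Y \<beta> \<nu>"
proof -
  interpret prob_space \<nu> by fact
  have "AE y in \<nu>. y \<in> conj_stab_points G H Y \<beta>"
    using assms(2) by (rule AE_prob_1)
  then show ?thesis
    unfolding no_essential_holonomy_def
    by eventually_elim (use trivial_holonomy_iff in \<open>auto simp: conj_stab_points_def\<close>)
qed

lemma IRS_supported_on_URS:
  assumes sets: "sets \<nu> = sets (borel_of Y)" and one: "measure \<nu> (conj_stab_points G H Y \<beta>) = 1"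
  shows "measure (stabilizer_IRS G \<beta> \<nu>) (stabilizer_URS G Y \<beta>) = 1"
proof -
  have "stabilizer G \<beta> \<in> measurable \<nu> (borel_of (chabauty G))"
    using stabilizer_measurable by (simp add: measurable_cong_sets[OF sets refl])
  then have "measure (stabilizer_IRS G \<beta> \<nu>) (conjugates G H) =
      measure \<nu> (stabilizer G \<beta> -` conjugates G H \<inter> space \<nu>)"
    unfolding stabilizer_IRS_def using closedin_in_borel_of[OF closedin_conjugates]
    by (rule measure_distr)
  also have "stabilizer G \<beta> -` conjugates G H \<inter> space \<nu> = conj_stab_points G H Y \<beta>"
    using sets_eq_imp_space_eq[OF sets] by (auto simp: conj_stab_points_def space_borel_of)
  finally show ?thesis
    by (simp add: one stabilizer_URS_eq)
qed

lemma factors_onto_cosets_of_factor: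
  assumes "factor_map G X \<alpha> Y \<beta> \<pi>"
  shows "factors_onto_cosets G X \<alpha> (normalizer G H)"
  using factor_map_compose[OF assms factor_map_conjugate_at]
    factors_onto_cosets_iff[OF is_group subgroup_H] by blast

end

section \<open>The equivalences\<close>

lemma conj_stab_factor_exists:
  fixes X :: "'x topology"
  assumes X: "minimal_system G X \<alpha>"
    and H: "subgroup H G" "finite H" "almost_normal G H"
    and free: "free_points G X \<alpha> \<noteq> {}"
    and cosets: "factors_onto_cosets G X \<alpha> (normalizer G H)"
  shows "\<exists>(Y :: 'x set topology) \<beta> \<pi>. conj_stab_factor G X \<alpha> H Y \<beta> \<pi>"
proof -
  interpret minimal_system G X \<alpha> by fact
  obtain L where "factor_map G X \<alpha> (discrete_topology (conjugates G H)) (conj_by G) L"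
    using cosets factors_onto_cosets_iff[OF is_group H(1)] by blast
  then interpret conjugate_field_system G X \<alpha> H L
    using X H free almost_normal_iff_finite_conjugates[OF H(1)]
    by (simp add: conjugate_field_system_def conjugate_field_system_axioms_def)
  show ?thesis
    using conj_stab_factor_L_orbit by blast
qed

lemma conjugate_stabilizer_system_of_factor:
  assumes X: "minimal_system G X \<alpha>"
    and H: "subgroup H G" "finite H" "almost_normal G H"
    and free: "free_points G X \<alpha> \<noteq> {}"
    and Y: "conj_stab_factor G X \<alpha> H Y \<beta> \<pi>"
  shows "conjugate_stabilizer_system G Y \<beta> H"
proof -
  interpret minimal_system G X \<alpha> by fact
  have "minimal_system G Y \<beta>"
    using Y by (simp add: conj_stab_factor_def)
  moreover have "conj_stab_points G H Y \<beta> \<noteq> {}"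
    using Y free by (auto simp: conj_stab_factor_def)
  ultimately show ?thesis
    using H almost_normal_iff_finite_conjugates[OF H(1)]
    by (simp add: conjugate_stabilizer_system_def conjugate_stabilizer_system_axioms_def)
qed

lemma conjugate_stabilizer_system_of_ae_factor:
  assumes X: "minimal_system G X \<alpha>"
    and H: "subgroup H G" "finite H"
    and inv: "invariant_measure G X \<alpha> \<mu>" and Y: "ae_conj_stab_factor G X \<alpha> \<mu> H Y \<beta> \<pi>"
  shows "conjugate_stabilizer_system G Y \<beta> H"
proof -
  interpret minimal_system G X \<alpha> by fact
  interpret Y: minimal_system G Y \<beta>
    using Y by (simp add: ae_conj_stab_factor_def)
  have one: "measure (distr \<mu> (borel_of Y) \<pi>) (conj_stab_points G H Y \<beta>) = 1"
    using Y by (simp add: ae_conj_stab_factor_def)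
  have "invariant_measure G Y \<beta> (distr \<mu> (borel_of Y) \<pi>)"
    using invariant_measure_factor[OF dynamical_system_axioms Y.dynamical_system_axioms _ inv] Y
    by (simp add: ae_conj_stab_factor_def)
  then have "finite (conjugates G H)"
    using one by (rule Y.finite_conjugates_of_invariant_measure[OF H(1)])
  moreover have "conj_stab_points G H Y \<beta> \<noteq> {}"
    using one by auto
  ultimately show ?thesis
    using H Y.minimal_system_axioms
    by (simp add: conjugate_stabilizer_system_def conjugate_stabilizer_system_axioms_def)
qed

lemma factors_onto_cosets_of_conj_stab_factor:
  assumes X: "minimal_system G X \<alpha>"
    and H: "subgroup H G" "finite H" "almost_normal G H"
    and free: "free_points G X \<alpha> \<noteq> {}"
    and Y: "conj_stab_factor G X \<alpha> H Y \<beta> \<pi>"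
  shows "factors_onto_cosets G X \<alpha> (normalizer G H)"
proof -
  interpret conjugate_stabilizer_system G Y \<beta> H
    using assms by (rule conjugate_stabilizer_system_of_factor)
  show ?thesis
    using Y factors_onto_cosets_of_factor by (auto simp: conj_stab_factor_def)
qed

lemma factors_onto_cosets_of_ae_factor:
  assumes X: "minimal_system G X \<alpha>" and H: "subgroup H G" "finite H"
    and inv: "invariant_measure G X \<alpha> \<mu>" and Y: "ae_conj_stab_factor G X \<alpha> \<mu> H Y \<beta> \<pi>"
  shows "almost_normal G H" "factors_onto_cosets G X \<alpha> (normalizer G H)"
proof -
  interpret conjugate_stabilizer_system G Y \<beta> H
    using assms by (rule conjugate_stabilizer_system_of_ae_factor)
  show "almost_normal G H"
    using almost_normal_iff_finite_conjugates[OF H(1)] finite_conjugates by simp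
  show "factors_onto_cosets G X \<alpha> (normalizer G H)"
    using Y factors_onto_cosets_of_factor by (auto simp: ae_conj_stab_factor_def)
qed

theorem theorem1p8:
  fixes G :: "('g, 'm) monoid_scheme"
    and X :: "'x topology" and \<alpha> :: "'g \<Rightarrow> 'x \<Rightarrow> 'x"
    and H :: "'g set"
  assumes "minimal_system G X \<alpha>"
    and "subgroup H G" and "finite H"
  shows
    "(topologically_free G X \<alpha> \<and> almost_normal G H \<longrightarrow>
        (factors_onto_cosets G X \<alpha> (normalizer G H) \<longleftrightarrow>
           (\<exists>(Y :: 'x set topology) \<beta> \<pi>. conj_stab_factor G X \<alpha> H Y \<beta> \<pi>)) \<and>
        (\<forall>(Y :: 'y topology) \<beta> \<pi>. conj_stab_factor G X \<alpha> H Y \<beta> \<pi> \<longrightarrow>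
           factors_onto_cosets G X \<alpha> (normalizer G H) \<and>
           conjugates G H = stabilizer_URS G Y \<beta> \<and>
           (\<forall>d. compatible_metric Y d \<longrightarrow> locally_quasi_analytic G Y \<beta> d)))
     \<and>
     (\<forall>\<mu>. ergodic_measure G X \<alpha> \<mu> \<and> essentially_free G \<alpha> \<mu> \<longrightarrow>
        (almost_normal G H \<and> factors_onto_cosets G X \<alpha> (normalizer G H) \<longleftrightarrow>
           (\<exists>(Y :: 'x set topology) \<beta> \<pi>. conj_stab_factor G X \<alpha> H Y \<beta> \<pi>)) \<and>
        (almost_normal G H \<and> factors_onto_cosets G X \<alpha> (normalizer G H) \<longleftrightarrow>
           (\<exists>(Y :: 'x set topology) \<beta> \<pi>. ae_conj_stab_factor G X \<alpha> \<mu> H Y \<beta> \<pi>)) \<and>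
        (\<forall>(Y :: 'y topology) \<beta> \<pi>. conj_stab_factor G X \<alpha> H Y \<beta> \<pi> \<longrightarrow>
           almost_normal G H \<and> factors_onto_cosets G X \<alpha> (normalizer G H)) \<and>
        (\<forall>(Y :: 'y topology) \<beta> \<pi>. ae_conj_stab_factor G X \<alpha> \<mu> H Y \<beta> \<pi> \<longrightarrow>
           almost_normal G H \<and> factors_onto_cosets G X \<alpha> (normalizer G H) \<and>
           conjugates G H = stabilizer_URS G Y \<beta> \<and>
           measure (stabilizer_IRS G \<beta> (distr \<mu> (borel_of Y) \<pi>)) (stabilizer_URS G Y \<beta>) = 1 \<and>
           no_essential_holonomy G Y \<beta> (distr \<mu> (borel_of Y) \<pi>) \<and>
           (\<forall>d. compatible_metric Y d \<longrightarrow> locally_quasi_analytic G Y \<beta> d)))"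
proof (intro conjI impI allI)
  interpret X: minimal_system G X \<alpha> by fact
  note H = assms(2,3)
  {
    assume "topologically_free G X \<alpha> \<and> almost_normal G H"
    then have an: "almost_normal G H" and free: "free_points G X \<alpha> \<noteq> {}"
      using X.free_point_of_topologically_free X.nonempty by auto
    note sys = conjugate_stabilizer_system_of_factor[OF assms(1) H an free]
    note cosets = factors_onto_cosets_of_conj_stab_factor[OF assms(1) H an free]
    show "factors_onto_cosets G X \<alpha> (normalizer G H) \<longleftrightarrow>
        (\<exists>(Y :: 'x set topology) \<beta> \<pi>. conj_stab_factor G X \<alpha> H Y \<beta> \<pi>)"
      using conj_stab_factor_exists[OF assms(1) H an free] cosets by metis
    fix Y :: "'y topology" and \<beta> \<pi>
    assume Y: "conj_stab_factor G X \<alpha> H Y \<beta> \<pi>"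
    show "factors_onto_cosets G X \<alpha> (normalizer G H)"
      using cosets[OF Y] .
    show "conjugates G H = stabilizer_URS G Y \<beta>"
      using conjugate_stabilizer_system.stabilizer_URS_eq[OF sys[OF Y]] by simp
    show "locally_quasi_analytic G Y \<beta> d" if "compatible_metric Y d" for d
      using conjugate_stabilizer_system.locally_quasi_analytic[OF sys[OF Y] that] .
  }
  fix \<mu> assume "ergodic_measure G X \<alpha> \<mu> \<and> essentially_free G \<alpha> \<mu>"
  then have inv: "invariant_measure G X \<alpha> \<mu>" and ess: "essentially_free G \<alpha> \<mu>"
    by (auto simp: ergodic_measure_def)
  then have sets: "sets \<mu> = sets (borel_of X)" and prob: "prob_space \<mu>"
    by (auto simp: invariant_measure_def)
  have free: "free_points G X \<alpha> \<noteq> {}"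
    using X.free_point_of_essentially_free[OF prob _ ess] sets_eq_imp_space_eq[OF sets]
    by (simp add: space_borel_of)
  note sys = conjugate_stabilizer_system_of_ae_factor[OF assms(1) H inv]
  note cosets = factors_onto_cosets_of_ae_factor[OF assms(1) H inv]
  note ae = X.conj_stab_factor_imp_ae[OF H(1) prob sets ess]
  show "almost_normal G H \<and> factors_onto_cosets G X \<alpha> (normalizer G H) \<longleftrightarrow>
      (\<exists>(Y :: 'x set topology) \<beta> \<pi>. conj_stab_factor G X \<alpha> H Y \<beta> \<pi>)"
    using conj_stab_factor_exists[OF assms(1) H _ free] cosets[OF ae] by metis
  show "almost_normal G H \<and> factors_onto_cosets G X \<alpha> (normalizer G H) \<longleftrightarrow>
      (\<exists>(Y :: 'x set topology) \<beta> \<pi>. ae_conj_stab_factor G X \<alpha> \<mu> H Y \<beta> \<pi>)"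
    using conj_stab_factor_exists[OF assms(1) H _ free] ae cosets by metis
  show "almost_normal G H" "factors_onto_cosets G X \<alpha> (normalizer G H)"
    if "conj_stab_factor G X \<alpha> H Y \<beta> \<pi>" for Y :: "'y topology" and \<beta> \<pi>
    using cosets[OF ae[OF that]] .
  fix Y :: "'y topology" and \<beta> \<pi>
  assume Y: "ae_conj_stab_factor G X \<alpha> \<mu> H Y \<beta> \<pi>"
  then interpret Y: conjugate_stabilizer_system G Y \<beta> H
    by (rule sys)
  have one: "measure (distr \<mu> (borel_of Y) \<pi>) (conj_stab_points G H Y \<beta>) = 1"
    and \<pi>: "factor_map G X \<alpha> Y \<beta> \<pi>"
    using Y by (simp_all add: ae_conj_stab_factor_def)
  have prob_Y: "prob_space (distr \<mu> (borel_of Y) \<pi>)"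
    using invariant_measure_factor[OF X.dynamical_system_axioms Y.dynamical_system_axioms \<pi> inv]
    by (simp add: invariant_measure_def)
  show "almost_normal G H" "factors_onto_cosets G X \<alpha> (normalizer G H)"
    using cosets[OF Y] .
  show "conjugates G H = stabilizer_URS G Y \<beta>"
    using Y.stabilizer_URS_eq by simp
  show "measure (stabilizer_IRS G \<beta> (distr \<mu> (borel_of Y) \<pi>)) (stabilizer_URS G Y \<beta>) = 1"
    using one by (intro Y.IRS_supported_on_URS) simp_all
  show "no_essential_holonomy G Y \<beta> (distr \<mu> (borel_of Y) \<pi>)"
    using Y.ae_trivial_holonomy[OF prob_Y one] .
  show "locally_quasi_analytic G Y \<beta> d" if "compatible_metric Y d" for d
    using Y.locally_quasi_analytic[OF that] .
qed

end
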